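(* Let $k,d\in\mathbb N$ and let $\{U_i,i\in\mathbb Z\}$ be the points of a Poisson process on $\mathbb R^k$ with constant intensity $\lambda>0$. Let $\{\xi_i(t),t\in\mathbb R^d\}$, $i\in\mathbb Z$, be independent copies, independent of the Poisson process, of a random field $\{\xi(t),t\in\mathbb R^d\}$ with values in $\mathbb R^k$ which has stationary increments. Define $$X(t)=\min_{i\in\mathbb Z}|U_i+\xi_i(t)|,\quad t\in\mathbb R^d,$$ where $|\cdot|$ is the Euclidean norm. Then the process $X$ is stationary and min-i.d. (i.e., $-X$ is max-i.d.).
   Context: A real-valued process $\{Y(t),t\in\mathbb R^d\}$ is max-i.d. (max-infinitely divisible) if for every $n\in\mathbb N$ it has the same finite-dimensional distributions as the pointwise maximum of some $n$ i.i.d. processes. A random field $\xi$ has stationary increments if for every $h\in\mathbb R^d$ the fields $\{\xi(t+h)-\xi(h),t\in\mathbb R^d\}$ and $\{\xi(t)-\xi(0),t\in\mathbb R^d\}$ have the same finite-dimensional distributions. *)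

theory Defs
  imports "HOL-Probability.Probability"
begin

text \<open>
  A field indexed by \<open>'t\<close> over a probability space \<open>M\<close> is a function
  \<open>Y :: 't \<Rightarrow> 'w \<Rightarrow> 'a\<close> all of whose coordinates \<open>Y t\<close> are random variables.
\<close>

definition random_field :: "'w measure \<Rightarrow> ('t \<Rightarrow> 'w \<Rightarrow> 'a::topological_space) \<Rightarrow> bool" where
  "random_field M Y \<longleftrightarrow> (\<forall>t. Y t \<in> borel_measurable M)"

definition same_fdd ::
  "'w measure \<Rightarrow> ('t \<Rightarrow> 'w \<Rightarrow> 'a::topological_space) \<Rightarrow> 'v measure \<Rightarrow> ('t \<Rightarrow> 'v \<Rightarrow> 'a) \<Rightarrow> bool" where
  "same_fdd M Y N Z \<longleftrightarrow>
     (\<forall>J. finite J \<longrightarrow>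
        distr M (PiM J (\<lambda>_. borel)) (\<lambda>\<omega>. \<lambda>t\<in>J. Y t \<omega>) =
        distr N (PiM J (\<lambda>_. borel)) (\<lambda>\<omega>. \<lambda>t\<in>J. Z t \<omega>))"

definition stationary ::
  "'w measure \<Rightarrow> ('t::ab_group_add \<Rightarrow> 'w \<Rightarrow> 'a::topological_space) \<Rightarrow> bool" where
  "stationary M Y \<longleftrightarrow>
     random_field M Y \<and> (\<forall>h. same_fdd M (\<lambda>t. Y (t + h)) M Y)"

definition stationary_increments ::
  "'w measure \<Rightarrow> ('t::ab_group_add \<Rightarrow> 'w \<Rightarrow> 'a::real_normed_vector) \<Rightarrow> bool" where
  "stationary_increments M Y \<longleftrightarrow>
     random_field M Y \<and>
     (\<forall>h. same_fdd M (\<lambda>t \<omega>. Y (t + h) \<omega> - Y h \<omega>) M (\<lambda>t \<omega>. Y t \<omega> - Y 0 \<omega>))"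

text \<open>
  HOL cannot quantify over the type of the sample space carrying the \<open>n\<close> i.i.d. processes.
  The canonical path space \<open>nat \<Rightarrow> 't \<Rightarrow> real\<close> is used instead; this loses nothing, since only
  the joint law of the processes matters, and that law lives on the path space.
\<close>

definition max_id :: "'w measure \<Rightarrow> ('t \<Rightarrow> 'w \<Rightarrow> real) \<Rightarrow> bool" where
  "max_id M Y \<longleftrightarrow>
     random_field M Y \<and>
     (\<forall>n::nat. n \<ge> 1 \<longrightarrow>
        (\<exists>(P :: (nat \<Rightarrow> 't \<Rightarrow> real) measure) (Z :: nat \<Rightarrow> 't \<Rightarrow> (nat \<Rightarrow> 't \<Rightarrow> real) \<Rightarrow> real).
           prob_space P \<and>
           (\<forall>j<n. random_field P (Z j)) \<and>
           prob_space.indep_vars P (\<lambda>_. PiM UNIV (\<lambda>_. borel)) (\<lambda>j \<omega> t. Z j t \<omega>) {..<n} \<and>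
           (\<forall>i<n. \<forall>j<n. same_fdd P (Z i) P (Z j)) \<and>
           same_fdd M Y P (\<lambda>t \<omega>. Max ((\<lambda>j. Z j t \<omega>) ` {..<n}))))"

definition min_id :: "'w measure \<Rightarrow> ('t \<Rightarrow> 'w \<Rightarrow> real) \<Rightarrow> bool" where
  "min_id M Y \<longleftrightarrow> max_id M (\<lambda>t \<omega>. - Y t \<omega>)"

text \<open>The number of points in \<open>A\<close>, possibly infinite.\<close>

definition point_count :: "('i \<Rightarrow> 'w \<Rightarrow> 'a) \<Rightarrow> 'a set \<Rightarrow> 'w \<Rightarrow> ennreal" where
  "point_count U A \<omega> = emeasure (count_space UNIV) {i. U i \<omega> \<in> A}"

text \<open>
  The random points \<open>U i\<close> enumerate a Poisson process with intensity measure \<open>\<Lambda>\<close>. The Poisson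
  probabilities are written out because \<^const>\<open>poisson_pmf\<close> excludes the rate 0, which is
  needed for \<open>\<Lambda>\<close>-null sets. As they sum to 1, the counts of sets of finite intensity are
  almost surely finite.
\<close>

definition poisson_process ::
  "'w measure \<Rightarrow> 'a::topological_space measure \<Rightarrow> ('i \<Rightarrow> 'w \<Rightarrow> 'a) \<Rightarrow> bool" where
  "poisson_process M \<Lambda> U \<longleftrightarrow>
     (\<forall>i. U i \<in> borel_measurable M) \<and>
     (\<forall>A\<in>sets borel. emeasure \<Lambda> A < \<infinity> \<longrightarrow>
        (\<forall>n. measure M {\<omega> \<in> space M. point_count U A \<omega> = of_nat n} =
             measure \<Lambda> A ^ n / fact n * exp (- measure \<Lambda> A))) \<and>
     (\<forall>\<A>. \<A> \<subseteq> {A \<in> sets borel. emeasure \<Lambda> A < \<infinity>} \<and> disjoint \<A> \<longrightarrow>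
        prob_space.indep_vars M (\<lambda>_. borel) (\<lambda>A. point_count U A) \<A>)"

definition field_sigma :: "'w measure \<Rightarrow> ('t \<Rightarrow> 'w \<Rightarrow> 'a::topological_space) \<Rightarrow> 'w set set" where
  "field_sigma M Y = sets (vimage_algebra (space M) (\<lambda>\<omega> t. Y t \<omega>) (PiM UNIV (\<lambda>_. borel)))"

end

theory Submission
  imports Defs
begin

text \<open>
  Fix a finite set \<open>J\<close> of indices and levels \<open>x t\<close>. The event that \<open>x t \<le> X t\<close> for all
  \<open>t \<in> J\<close> says that no marked point \<open>(U i, \<xi>' i)\<close> lies in the set of pairs \<open>(u, y)\<close> with
  \<open>norm (u + y t) < x t\<close> for some \<open>t \<in> J\<close>. The marked points form a Poisson process on the
  product space, so this event has probability \<open>exp (- rate * V J x)\<close>, where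
  \<open>V J x\<close> is the expected volume of \<open>\<Union>t\<in>J. ball (- \<xi> t) (x t)\<close>. Such events generate the
  \<open>\<sigma>\<close>-algebra of the finite-dimensional distributions and are stable under intersection, so
  the functional \<open>V\<close> and the rate determine the law of \<open>X\<close>, and both distributional claims
  become statements about \<open>V\<close>.

  Stationarity: volume is invariant under translation, so subtracting \<open>\<xi> h\<close> from all values
  of the field does not change the union's volume. Hence \<open>V\<close> depends on the increments of
  \<open>\<xi>\<close> only, and these are stationary.

  Min-infinite divisibility: \<open>exp (- rate * V)\<close> is the \<open>n\<close>-th power of
  \<open>exp (- (rate / n) * V)\<close>, and the latter belongs to the process built in the same way from
  a Poisson process of rate \<open>rate / n\<close>. Multiplying all the points \<open>U i\<close> by \<open>n\<close> to the
  power of \<open>1 / k\<close>, with \<open>k\<close> the dimension of the space of points, produces such a Poisson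
  process, with the same marks. The minimum of \<open>n\<close> independent
  copies of the resulting process therefore has the law of \<open>X\<close>.

  The void probability is computed without constructing the marked Poisson process. Given the
  points, the marks are independent, so averaging over them first turns the event into the
  product of \<open>1 - p (U i)\<close> over all \<open>i\<close>, where \<open>p u\<close> is the probability that a mark moves
  \<open>u\<close> into the forbidden region (\<open>integrate_out_marks\<close>). The expectation of this product is
  \<open>exp (- \<integral> p)\<close>, the integral being over the intensity
  (\<open>poisson_process_generating_functional\<close>), and Tonelli's theorem identifies it with
  \<open>rate * V\<close> (\<open>void_probability\<close>).

  The infimum is attained because the expected number of displaced points in a ball is the rate
  times the volume of the ball, hence finite (\<open>locally_finite\<close>).
\<close>

section \<open>Laws of real random fields from orthant probabilities\<close>

text \<open>
  Closed upper half-lines generate the Borel sets of the line, and countably many of them cover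
  it; this covering is what makes the boxes with these sides generate the product.
\<close>

lemma sets_PiM_Ici:
  fixes J :: "'t set"
  assumes "finite J"
  shows "sets (PiM J (\<lambda>_. borel :: real measure)) =
    sigma_sets (J \<rightarrow>\<^sub>E UNIV) (range (\<lambda>a. {f \<in> J \<rightarrow>\<^sub>E UNIV. \<forall>t\<in>J. a t \<le> f t}))"
proof -
  let ?E = "range (\<lambda>a::real. {a..})"
  have cov: "\<exists>S\<subseteq>?E. countable S \<and> (UNIV :: real set) = \<Union>S"
  proof (intro exI[of _ "range (\<lambda>n::nat. {- real n..})"] conjI)
    show "UNIV = \<Union> (range (\<lambda>n::nat. {- real n..}))"
    proof (safe, simp)
      fix x :: real
      obtain n :: nat where "- x \<le> real n" using real_arch_simple by blast
      then show "\<exists>n::nat. - real n \<le> x" by (intro exI[of _ n]) simp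
    qed simp
  qed auto
  have "sets (PiM J (\<lambda>_. borel :: real measure)) = sets (PiM J (\<lambda>_. sigma (UNIV :: real set) ?E))"
    by (simp add: borel_Ici)
  also have "\<dots> = sets (sigma (J \<rightarrow>\<^sub>E UNIV)
      {{f \<in> J \<rightarrow>\<^sub>E UNIV. \<forall>i\<in>j. f i \<in> A i} | A j. j \<in> {J} \<and> A \<in> Pi j (\<lambda>_. ?E)})"
    using assms cov by (intro sets_PiM_sigma) auto
  also have "{{f \<in> J \<rightarrow>\<^sub>E UNIV. \<forall>i\<in>j. f i \<in> A i} | A j. j \<in> {J} \<and> A \<in> Pi j (\<lambda>_. ?E)} =
      range (\<lambda>a. {f \<in> J \<rightarrow>\<^sub>E UNIV. \<forall>t\<in>J. a t \<le> f t})" (is "?L = ?R")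
  proof (intro set_eqI iffI)
    fix X assume "X \<in> ?L"
    then obtain A where X: "X = {f \<in> J \<rightarrow>\<^sub>E UNIV. \<forall>i\<in>J. f i \<in> A i}"
      and A: "\<And>i. i \<in> J \<Longrightarrow> A i \<in> ?E" by auto
    from A have "\<forall>i\<in>J. \<exists>a. A i = {a..}" by blast
    then obtain a where "\<forall>i\<in>J. A i = {a i..}" by metis
    then have "X = {f \<in> J \<rightarrow>\<^sub>E UNIV. \<forall>t\<in>J. a t \<le> f t}" unfolding X by auto
    then show "X \<in> ?R" by blast
  next
    fix X assume "X \<in> ?R"
    then obtain a where X: "X = {f \<in> J \<rightarrow>\<^sub>E UNIV. \<forall>t\<in>J. a t \<le> f t}" by blast
    show "X \<in> ?L"
      unfolding X by (intro CollectI exI[of _ "\<lambda>t. {a t..}"] exI[of _ J]) auto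
  qed
  finally show ?thesis
    by (subst (asm) sets_measure_of) auto
qed

lemma random_field_restrict_measurable:
  assumes "random_field M Y"
  shows "(\<lambda>\<omega>. \<lambda>t\<in>J. Y t \<omega>) \<in> measurable M (PiM J (\<lambda>_. borel))"
  using assms unfolding random_field_def by (intro measurable_restrict) auto

text \<open>
  Upper orthants are the right test sets for a minimum: an infimum is at least \<open>a\<close> exactly when
  all of its terms are. They are closed under intersection and generate, so agreement on them
  suffices.
\<close>

lemma same_fdd_if_upper_orthants:
  fixes Y :: "'t \<Rightarrow> 'w \<Rightarrow> real" and Z :: "'t \<Rightarrow> 'v \<Rightarrow> real"
  assumes "prob_space M" "prob_space N" "random_field M Y" "random_field N Z"
    and eq: "\<And>J a. finite J \<Longrightarrow> measure M {\<omega> \<in> space M. \<forall>t\<in>J. a t \<le> Y t \<omega>} =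
      measure N {\<omega> \<in> space N. \<forall>t\<in>J. a t \<le> Z t \<omega>}"
  shows "same_fdd M Y N Z"
  unfolding same_fdd_def
proof (intro allI impI)
  fix J :: "'t set" assume J: "finite J"
  interpret M: prob_space M by fact
  interpret N: prob_space N by fact
  let ?O = "\<lambda>a. {f \<in> J \<rightarrow>\<^sub>E UNIV. \<forall>t\<in>J. a t \<le> (f t :: real)}"
  let ?P = "PiM J (\<lambda>_. borel :: real measure)"
  note [measurable] = random_field_restrict_measurable[OF assms(3), of J]
    random_field_restrict_measurable[OF assms(4), of J]
  have O: "?O a \<in> sets ?P" for a
    unfolding sets_PiM_Ici[OF J] by (rule sigma_sets.Basic) simp
  have M_eq: "emeasure (distr M ?P (\<lambda>\<omega>. \<lambda>t\<in>J. Y t \<omega>)) (?O a) =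
      ennreal (measure M {\<omega> \<in> space M. \<forall>t\<in>J. a t \<le> Y t \<omega>})" for a
    using O[of a] by (subst emeasure_distr)
      (auto simp: M.emeasure_eq_measure intro!: arg_cong[where f="measure M"])
  have N_eq: "emeasure (distr N ?P (\<lambda>\<omega>. \<lambda>t\<in>J. Z t \<omega>)) (?O a) =
      ennreal (measure N {\<omega> \<in> space N. \<forall>t\<in>J. a t \<le> Z t \<omega>})" for a
    using O[of a] by (subst emeasure_distr)
      (auto simp: N.emeasure_eq_measure intro!: arg_cong[where f="measure N"])
  show "distr M ?P (\<lambda>\<omega>. \<lambda>t\<in>J. Y t \<omega>) = distr N ?P (\<lambda>\<omega>. \<lambda>t\<in>J. Z t \<omega>)"
  proof (rule measure_eqI_generator_eq[where E = "range ?O" and \<Omega> = "J \<rightarrow>\<^sub>E UNIV" and A = "\<lambda>n. ?O (\<lambda>_. - real n)"])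
    show "Int_stable (range ?O)"
    proof (rule Int_stableI_image)
      fix a b
      show "\<exists>c\<in>UNIV. ?O a \<inter> ?O b = ?O c"
        by (intro bexI[of _ "\<lambda>t. max (a t) (b t)"]) auto
    qed
    show "emeasure (distr M ?P (\<lambda>\<omega>. \<lambda>t\<in>J. Y t \<omega>)) X = emeasure (distr N ?P (\<lambda>\<omega>. \<lambda>t\<in>J. Z t \<omega>)) X"
      if "X \<in> range ?O" for X
      using that M_eq N_eq eq[OF J] by auto
    show "(\<Union>n. ?O (\<lambda>_. - real n)) = J \<rightarrow>\<^sub>E UNIV"
    proof (intro equalityI subsetI)
      fix f :: "'t \<Rightarrow> real" assume f: "f \<in> J \<rightarrow>\<^sub>E UNIV"
      obtain n :: nat where n: "(\<Sum>t\<in>J. \<bar>f t\<bar>) \<le> real n" using real_arch_simple by blast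
      have "- real n \<le> f t" if "t \<in> J" for t
      proof -
        have "\<bar>f t\<bar> \<le> (\<Sum>t\<in>J. \<bar>f t\<bar>)"
          using J that by (intro member_le_sum) auto
        then show ?thesis using n by linarith
      qed
      then show "f \<in> (\<Union>n. ?O (\<lambda>_. - real n))" using f by auto
    qed auto
  qed (auto simp: sets_PiM_Ici[OF J] M_eq)
qed

lemma same_fdd_compose:
  assumes "random_field M Y" "random_field N Z" "same_fdd M Y N Z"
    and f: "f \<in> borel_measurable borel"
  shows "same_fdd M (\<lambda>t \<omega>. f (Y t \<omega>)) N (\<lambda>t \<omega>. f (Z t \<omega>))"
  unfolding same_fdd_def
proof (intro allI impI)
  fix J :: "'b set" assume J: "finite J"
  let ?P = "PiM J (\<lambda>_. borel)" and ?g = "\<lambda>y. \<lambda>t\<in>J. f (y t)"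
  have g: "?g \<in> measurable ?P ?P"
    using f by measurable
  have "distr M ?P (\<lambda>\<omega>. \<lambda>t\<in>J. f (Y t \<omega>)) = distr (distr M ?P (\<lambda>\<omega>. \<lambda>t\<in>J. Y t \<omega>)) ?P ?g"
    using random_field_restrict_measurable[OF assms(1)] g
    by (subst distr_distr) (auto simp: comp_def cong: restrict_cong intro!: distr_cong)
  also have "\<dots> = distr (distr N ?P (\<lambda>\<omega>. \<lambda>t\<in>J. Z t \<omega>)) ?P ?g"
    using assms(3) J by (simp add: same_fdd_def)
  also have "\<dots> = distr N ?P (\<lambda>\<omega>. \<lambda>t\<in>J. f (Z t \<omega>))"
    using random_field_restrict_measurable[OF assms(2)] g
    by (subst distr_distr) (auto simp: comp_def cong: restrict_cong intro!: distr_cong)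
  finally show "distr M ?P (\<lambda>\<omega>. \<lambda>t\<in>J. f (Y t \<omega>)) = distr N ?P (\<lambda>\<omega>. \<lambda>t\<in>J. f (Z t \<omega>))" .
qed

section \<open>Independence\<close>

lemma (in prob_space) indep_vars_reindex:
  assumes "indep_vars M' X (f ` I)" "inj_on f I"
  shows "indep_vars (\<lambda>i. M' (f i)) (\<lambda>i. X (f i)) I"
  unfolding indep_vars_def2
proof (intro conjI ballI)
  show "X (f i) \<in> measurable M (M' (f i))" if "i \<in> I" for i
    using assms(1) that by (auto simp: indep_vars_def2)
  let ?S = "\<lambda>j. {X j -` A \<inter> space M |A. A \<in> sets (M' j)}"
  have S: "indep_sets ?S (f ` I)" using assms(1) by (simp add: indep_vars_def2)
  show "indep_sets (\<lambda>i. ?S (f i)) I"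
    unfolding indep_sets_def
  proof (intro conjI ballI allI impI)
    fix i assume "i \<in> I"
    then show "?S (f i) \<subseteq> events" using S unfolding indep_sets_def by blast
  next
    fix K A assume K: "K \<subseteq> I" "K \<noteq> {}" "finite K" and A: "A \<in> (\<Pi> j\<in>K. ?S (f j))"
    have inj: "inj_on f K" using assms(2) K(1) by (rule inj_on_subset)
    define B where "B j = A (the_inv_into K f j)" for j
    have B: "B (f k) = A k" if "k \<in> K" for k
      using that inj by (simp add: B_def the_inv_into_f_f)
    have "prob (\<Inter>j\<in>f ` K. B j) = (\<Prod>j\<in>f ` K. prob (B j))"
    proof (rule indep_setsD[OF S])
      show "\<forall>j\<in>f ` K. B j \<in> ?S j"
      proof
        fix j assume "j \<in> f ` K"
        then obtain k where k: "k \<in> K" "j = f k" by auto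
        show "B j \<in> ?S j" using A k by (simp only: k(2) B[OF k(1)]) (erule Pi_mem)
      qed
    qed (use K in auto)
    then show "prob (\<Inter>j\<in>K. A j) = (\<Prod>j\<in>K. prob (A j))"
      using inj B by (simp add: prod.reindex)
  qed
qed

lemma vimage_in_field_sigma:
  assumes g: "g \<in> measurable (PiM UNIV (\<lambda>_. borel)) S" and A: "A \<in> sets S"
  shows "(\<lambda>\<omega>. g (\<lambda>t. Y t \<omega>)) -` A \<inter> space M \<in> field_sigma M Y"
proof -
  let ?V = "vimage_algebra (space M) (\<lambda>\<omega> t. Y t \<omega>) (PiM UNIV (\<lambda>_. borel))"
  have "(\<lambda>\<omega>. g (\<lambda>t. Y t \<omega>)) \<in> measurable ?V S"
    by (rule measurable_compose[OF measurable_vimage_algebra1 g]) (auto simp: space_PiM)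
  from measurable_sets[OF this A] show ?thesis by (simp add: field_sigma_def)
qed

text \<open>
  Rectangles determine the joint law, and on them the claim is the product rule. The two maps may
  take values in different types, as points and marks do.
\<close>

lemma (in prob_space) distr_pair_if_indep_set:
  assumes u: "u \<in> measurable M S" and y: "y \<in> measurable M T" and indep: "indep_set \<F> \<G>"
    and "\<And>A. A \<in> sets S \<Longrightarrow> u -` A \<inter> space M \<in> \<F>" "\<And>B. B \<in> sets T \<Longrightarrow> y -` B \<inter> space M \<in> \<G>"
  shows "distr M S u \<Otimes>\<^sub>M distr M T y = distr M (S \<Otimes>\<^sub>M T) (\<lambda>\<omega>. (u \<omega>, y \<omega>))"
proof -
  interpret S: prob_space "distr M S u" using u by (rule prob_space_distr)
  interpret T: prob_space "distr M T y" using y by (rule prob_space_distr)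
  show ?thesis
  proof (rule pair_measure_eqI)
    fix A B assume "A \<in> sets (distr M S u)" "B \<in> sets (distr M T y)"
    then have A: "A \<in> sets S" and B: "B \<in> sets T" by auto
    have "(\<lambda>\<omega>. (u \<omega>, y \<omega>)) -` (A \<times> B) \<inter> space M = (u -` A \<inter> space M) \<inter> (y -` B \<inter> space M)"
      by auto
    moreover have "prob \<dots> = prob (u -` A \<inter> space M) * prob (y -` B \<inter> space M)"
      using assms A B by (intro indep_setD[OF indep]) auto
    ultimately show "emeasure (distr M S u) A * emeasure (distr M T y) B =
        emeasure (distr M (S \<Otimes>\<^sub>M T) (\<lambda>\<omega>. (u \<omega>, y \<omega>))) (A \<times> B)"
      using u y A B by (simp add: emeasure_distr emeasure_eq_measure ennreal_mult)
  qed (auto intro: S.sigma_finite_measure_axioms T.sigma_finite_measure_axioms)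
qed

section \<open>Counts of a Poisson process\<close>

lemma poisson_process_indep_counts:
  assumes "poisson_process M \<Lambda> U" "\<A> \<subseteq> {A \<in> sets borel. emeasure \<Lambda> A < \<infinity>}" "disjoint \<A>"
  shows "prob_space.indep_vars M (\<lambda>_. borel) (\<lambda>A. point_count U A) \<A>"
  using assms by (simp add: poisson_process_def)

lemma poisson_process_count_measurable:
  assumes "prob_space M" "poisson_process M \<Lambda> U" "A \<in> sets borel" "emeasure \<Lambda> A < \<infinity>"
  shows "point_count U A \<in> borel_measurable M"
proof -
  interpret prob_space M by fact
  have "indep_vars (\<lambda>_. borel) (\<lambda>A. point_count U A) {A}"
    using assms by (auto simp: poisson_process_def)
  then show ?thesis
    by (auto simp: indep_vars_def)
qed

lemma poisson_weights_sums:
  fixes q m :: real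
  shows "(\<lambda>n. q ^ n * (m ^ n / fact n * exp (- m))) sums exp (- ((1 - q) * m))"
proof -
  have "(\<lambda>n. (q * m) ^ n /\<^sub>R fact n * exp (- m)) sums (exp (q * m) * exp (- m))"
    by (intro sums_mult2 exp_converges)
  also have "(\<lambda>n. (q * m) ^ n /\<^sub>R fact n * exp (- m)) = (\<lambda>n. q ^ n * (m ^ n / fact n * exp (- m)))"
    by (simp add: fun_eq_iff power_mult_distrib divide_inverse mult_ac)
  also have "exp (q * m) * exp (- m) = exp (- ((1 - q) * m))"
    by (simp add: exp_add[symmetric] algebra_simps)
  finally show ?thesis .
qed

text \<open>
  The mean of the Poisson distribution: \<open>n / fact n\<close> cancels to \<open>1 / fact (n - 1)\<close>, which reduces
  the series to the total mass of the weights.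
\<close>

lemma poisson_mean_sums:
  fixes m :: real
  shows "(\<lambda>n. real n * (m ^ n / fact n * exp (- m))) sums m"
proof -
  have "(\<lambda>n. m * (1 ^ n * (m ^ n / fact n * exp (- m)))) sums (m * exp (- ((1 - 1) * m)))"
    by (intro sums_mult poisson_weights_sums)
  then have "(\<lambda>n. real (Suc n) * (m ^ Suc n / fact (Suc n) * exp (- m))) sums m"
    by (simp add: field_simps del: of_nat_Suc)
  then show ?thesis
    by (subst (asm) sums_Suc_iff) simp
qed

text \<open>
  The Poisson weights add up to \<open>1\<close>, so a count is almost surely one of the natural numbers, and
  expectations of functions of it become series against the weights.
\<close>

lemma poisson_process_count:
  assumes "prob_space M" and U: "poisson_process M \<Lambda> U"
    and A: "A \<in> sets borel" "emeasure \<Lambda> A < \<infinity>"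
  shows poisson_process_count_finite: "AE \<omega> in M. point_count U A \<omega> < \<infinity>"
    and poisson_process_nn_integral_count:
      "(\<integral>\<^sup>+\<omega>. f (point_count U A \<omega>) \<partial>M) =
        (\<Sum>n. f (of_nat n) * ennreal (measure \<Lambda> A ^ n / fact n * exp (- measure \<Lambda> A)))"
proof -
  interpret prob_space M by fact
  let ?K = "point_count U A" and ?m = "measure \<Lambda> A"
  define E where "E n = {\<omega> \<in> space M. ?K \<omega> = of_nat n}" for n
  have [measurable]: "?K \<in> borel_measurable M"
    using assms by (rule poisson_process_count_measurable)
  have E[measurable]: "E n \<in> events" for n
    unfolding E_def by measurable
  have prob_E: "prob (E n) = ?m ^ n / fact n * exp (- ?m)" for n
    using U A by (auto simp: poisson_process_def E_def)
  have "(\<lambda>n. prob (E n)) sums prob (\<Union>n. E n)"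
    by (intro finite_measure_UNION) (auto simp: E_def disjoint_family_on_def)
  moreover have "(\<lambda>n. prob (E n)) sums 1"
    using poisson_weights_sums[of 1 ?m] by (simp add: prob_E)
  ultimately have "prob (\<Union>n. E n) = 1"
    by (rule sums_unique2)
  then have AE_E: "AE \<omega> in M. \<omega> \<in> (\<Union>n. E n)"
    by (rule AE_prob_1)
  then show "AE \<omega> in M. ?K \<omega> < \<infinity>"
    by eventually_elim (auto simp: E_def of_nat_less_top)
  have "(\<integral>\<^sup>+\<omega>. f (?K \<omega>) \<partial>M) = (\<integral>\<^sup>+\<omega>. (\<Sum>n. f (of_nat n) * indicator (E n) \<omega>) \<partial>M)"
  proof (rule nn_integral_cong_AE)
    show "AE \<omega> in M. f (?K \<omega>) = (\<Sum>n. f (of_nat n) * indicator (E n) \<omega>)"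
      using AE_E
    proof eventually_elim
      case (elim \<omega>)
      then obtain k where k: "\<omega> \<in> E k" by blast
      have "(\<Sum>n. f (of_nat n) * indicator (E n) \<omega>) =
          (\<Sum>n\<in>{k}. f (of_nat n) * indicator (E n) \<omega>)"
        using k by (intro suminf_finite) (auto simp: E_def indicator_def)
      also have "\<dots> = f (of_nat k)" using k by simp
      also have "of_nat k = ?K \<omega>" using k by (simp add: E_def)
      finally show ?case by (rule sym)
    qed
  qed
  also have "\<dots> = (\<Sum>n. f (of_nat n) * emeasure M (E n))"
    by (subst nn_integral_suminf) (auto simp: nn_integral_cmult_indicator)
  finally show "(\<integral>\<^sup>+\<omega>. f (?K \<omega>) \<partial>M) =
      (\<Sum>n. f (of_nat n) * ennreal (?m ^ n / fact n * exp (- ?m)))"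
    by (simp add: emeasure_eq_measure prob_E)
qed

lemma poisson_process_mean_count:
  assumes "prob_space M" "poisson_process M \<Lambda> U" "A \<in> sets borel" "emeasure \<Lambda> A < \<infinity>"
  shows "(\<integral>\<^sup>+\<omega>. point_count U A \<omega> \<partial>M) = emeasure \<Lambda> A"
proof -
  have "(\<integral>\<^sup>+\<omega>. point_count U A \<omega> \<partial>M) =
      (\<Sum>n. ennreal (real n * (measure \<Lambda> A ^ n / fact n * exp (- measure \<Lambda> A))))"
    unfolding poisson_process_nn_integral_count[OF assms, of "\<lambda>x. x"]
    by (intro suminf_cong) (subst ennreal_mult', simp_all only: ennreal_of_nat_eq_real_of_nat of_nat_0_le_iff)
  also have "\<dots> = ennreal (measure \<Lambda> A)"
    by (intro suminf_ennreal_eq poisson_mean_sums) auto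
  finally show ?thesis
    using assms(4) by (simp add: emeasure_eq_ennreal_measure less_top)
qed

text \<open>
  The integer-valued part of the extended count is taken so that the power is defined; it
  differs from the count only where the count is infinite, which is a null set.
\<close>

lemma poisson_process_count_pgf:
  assumes "prob_space M" "poisson_process M \<Lambda> U" "A \<in> sets borel" "emeasure \<Lambda> A < \<infinity>"
    and "0 \<le> q"
  shows "(\<integral>\<^sup>+\<omega>. ennreal (q ^ nat \<lfloor>enn2real (point_count U A \<omega>)\<rfloor>) \<partial>M) =
    ennreal (exp (- ((1 - q) * measure \<Lambda> A)))"
proof -
  have "(\<integral>\<^sup>+\<omega>. ennreal (q ^ nat \<lfloor>enn2real (point_count U A \<omega>)\<rfloor>) \<partial>M) =
      (\<Sum>n. ennreal (q ^ n * (measure \<Lambda> A ^ n / fact n * exp (- measure \<Lambda> A))))"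
    unfolding poisson_process_nn_integral_count[OF assms(1-4),
      of "\<lambda>x. ennreal (q ^ nat \<lfloor>enn2real x\<rfloor>)"]
    using \<open>0 \<le> q\<close>
    by (intro suminf_cong) (subst ennreal_mult', simp_all only: zero_le_power enn2real_of_nat floor_of_nat nat_int)
  also have "\<dots> = ennreal (exp (- ((1 - q) * measure \<Lambda> A)))"
    using \<open>0 \<le> q\<close> by (intro suminf_ennreal_eq poisson_weights_sums) auto
  finally show ?thesis .
qed

section \<open>The generating functional of a Poisson process\<close>

text \<open>
  Finite sets of indices that exhaust a countable index type. Products over all points are
  understood as decreasing limits of products over these sets.
\<close>

definition initial_indices :: "nat \<Rightarrow> 'i::countable set" where
  "initial_indices N = {i. to_nat i < N}"

lemma finite_initial_indices [simp]: "finite (initial_indices N)"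
proof -
  have "finite (to_nat -` {..<N} :: 'a set)" by (intro finite_vimageI) auto
  then show ?thesis by (simp add: initial_indices_def vimage_def)
qed

lemma initial_indices_mono: "N \<le> N' \<Longrightarrow> initial_indices N \<subseteq> initial_indices N'"
  by (auto simp: initial_indices_def)

lemma finite_subset_initial_indices:
  fixes S :: "'i::countable set"
  assumes "finite S"
  obtains N where "S \<subseteq> initial_indices N"
proof -
  have "finite (to_nat ` S)" using assms by simp
  then obtain N where "\<forall>n\<in>to_nat ` S. n < N" by (auto simp: finite_nat_set_iff_bounded)
  then show ?thesis by (intro that[of N]) (auto simp: initial_indices_def)
qed

lemma prod_unit_interval_antimono:
  fixes g :: "'i \<Rightarrow> real"
  assumes "A \<subseteq> B" "finite B" "\<And>i. 0 \<le> g i" "\<And>i. g i \<le> 1"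
  shows "prod g B \<le> prod g A"
proof -
  have "prod g B = prod g (B - A) * prod g A"
    using assms by (intro prod.subset_diff)
  also have "\<dots> \<le> 1 * prod g A"
    using assms by (intro mult_right_mono prod_le_1 prod_nonneg) auto
  finally show ?thesis by simp
qed

text \<open>
  If \<open>p\<close> takes finitely many values, the product over the points groups into
  \<open>(1 - c) ^ K c\<close>, with \<open>K c\<close> the number of points in the level set of \<open>c\<close>. The level sets
  are disjoint, so the counts are independent and the expectation factors into probability
  generating functions. Level sets of nonzero values have finite intensity because \<open>p\<close> is
  integrable; the value \<open>0\<close> contributes only factors \<open>1\<close>.
\<close>

lemma poisson_process_generating_functional_simple:
  fixes U :: "'i::countable \<Rightarrow> 'w \<Rightarrow> 'a::topological_space" and p :: "'a \<Rightarrow> real"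
  assumes "prob_space M" and U: "poisson_process M \<Lambda> U" and sets_L: "sets \<Lambda> = sets borel"
    and p[measurable]: "p \<in> borel_measurable borel" and "finite (range p)"
    and p0: "\<And>x. 0 \<le> p x" and p1: "\<And>x. p x \<le> 1"
    and p_int: "(\<integral>\<^sup>+x. ennreal (p x) \<partial>\<Lambda>) < \<infinity>"
  shows "(\<integral>\<^sup>+\<omega>. (INF N. ennreal (\<Prod>i\<in>initial_indices N. 1 - p (U i \<omega>))) \<partial>M) =
    ennreal (exp (- enn2real (\<integral>\<^sup>+x. ennreal (p x) \<partial>\<Lambda>)))"
proof -
  interpret prob_space M by fact
  define C where "C = range p - {0}"
  define A where "A c = p -` {c}" for c
  define K where "K c = point_count U (A c)" for c
  have fin_C: "finite C" using \<open>finite (range p)\<close> by (simp add: C_def)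
  have C: "0 < c" "c \<le> 1" if "c \<in> C" for c
    using that p0 p1 by (auto simp: C_def less_le)
  have A_sets: "A c \<in> sets borel" for c
    unfolding A_def using measurable_sets[OF p, of "{c}"] by simp
  have A_sets': "A c \<in> sets \<Lambda>" for c
    using A_sets sets_L by simp
  have A_fin: "emeasure \<Lambda> (A c) < \<infinity>" if "c \<in> C" for c
  proof -
    have "ennreal c * emeasure \<Lambda> (A c) = (\<integral>\<^sup>+x. ennreal c * indicator (A c) x \<partial>\<Lambda>)"
      using A_sets' by (simp add: nn_integral_cmult_indicator)
    also have "\<dots> \<le> (\<integral>\<^sup>+x. ennreal (p x) \<partial>\<Lambda>)"
      by (intro nn_integral_mono) (auto simp: A_def indicator_def)
    finally have "ennreal c * emeasure \<Lambda> (A c) < \<infinity>" using p_int by (rule le_less_trans)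
    then show ?thesis
      using C[OF that] by (auto simp: ennreal_mult_less_top)
  qed
  have p_eq: "ennreal (p x) = (\<Sum>c\<in>C. ennreal c * indicator (A c) x)" for x
  proof (cases "p x = 0")
    case True
    then show ?thesis by (auto simp: C_def A_def indicator_def intro!: sum.neutral[symmetric])
  next
    case False
    then have "p x \<in> C" by (simp add: C_def)
    then have "(\<Sum>c\<in>C. ennreal c * indicator (A c) x) = (\<Sum>c\<in>{p x}. ennreal c * indicator (A c) x)"
      using fin_C by (intro sum.mono_neutral_right) (auto simp: A_def)
    then show ?thesis by (simp add: A_def)
  qed
  have "(\<integral>\<^sup>+x. ennreal (p x) \<partial>\<Lambda>) = (\<Sum>c\<in>C. ennreal c * emeasure \<Lambda> (A c))"
    unfolding p_eq using A_sets' by (subst nn_integral_sum) (auto simp: nn_integral_cmult_indicator)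
  also have "\<dots> = (\<Sum>c\<in>C. ennreal (c * measure \<Lambda> (A c)))"
    using A_fin C by (intro sum.cong)
      (auto simp: emeasure_eq_ennreal_measure less_top ennreal_mult less_imp_le)
  also have "\<dots> = ennreal (\<Sum>c\<in>C. c * measure \<Lambda> (A c))"
    using C by (intro sum_ennreal) (auto simp: less_imp_le)
  finally have int_p: "enn2real (\<integral>\<^sup>+x. ennreal (p x) \<partial>\<Lambda>) = (\<Sum>c\<in>C. c * measure \<Lambda> (A c))"
    using C by (simp add: sum_nonneg less_imp_le)
  have prod_eq: "(INF N. ennreal (\<Prod>i\<in>initial_indices N. 1 - p (U i \<omega>))) =
      (\<Prod>c\<in>C. ennreal ((1 - c) ^ nat \<lfloor>enn2real (K c \<omega>)\<rfloor>))"
    if fin: "\<forall>c\<in>C. K c \<omega> < \<infinity>" for \<omega>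
  proof -
    define F where "F c = {i. p (U i \<omega>) = c}" for c
    have K_F: "K c \<omega> = emeasure (count_space UNIV) (F c)" for c
      by (simp add: K_def point_count_def A_def F_def)
    have fin_F: "finite (F c)" if "c \<in> C" for c
      using fin that unfolding K_F by (auto simp: emeasure_count_space split: if_splits)
    have K_card: "nat \<lfloor>enn2real (K c \<omega>)\<rfloor> = card (F c)" if "c \<in> C" for c
      using fin_F[OF that] unfolding K_F by (simp add: emeasure_count_space)
    define S where "S = {i. p (U i \<omega>) \<noteq> 0}"
    have "S = (\<Union>c\<in>C. F c)" by (auto simp: S_def C_def F_def)
    then have fin_S: "finite S" using fin_C fin_F by simp
    \<comment> \<open>Only finitely many factors differ from \<open>1\<close>, so the partial products are eventually constant.\<close>
    obtain N0 where N0: "S \<subseteq> initial_indices N0" using fin_S by (rule finite_subset_initial_indices)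
    let ?P = "\<lambda>N. \<Prod>i\<in>initial_indices N. 1 - p (U i \<omega>)"
    have P_S: "?P N = (\<Prod>i\<in>S. 1 - p (U i \<omega>))" if "N0 \<le> N" for N
      using N0 initial_indices_mono[OF that] by (intro prod.mono_neutral_right) (auto simp: S_def)
    have "(INF N. ennreal (?P N)) = ennreal (\<Prod>i\<in>S. 1 - p (U i \<omega>))"
    proof (rule antisym)
      show "(INF N. ennreal (?P N)) \<le> ennreal (\<Prod>i\<in>S. 1 - p (U i \<omega>))"
        using P_S[of N0] by (intro INF_lower2[of N0]) auto
      show "ennreal (\<Prod>i\<in>S. 1 - p (U i \<omega>)) \<le> (INF N. ennreal (?P N))"
      proof (intro INF_greatest ennreal_leI)
        fix N
        have "(\<Prod>i\<in>S. 1 - p (U i \<omega>)) = ?P (max N N0)" by (simp add: P_S)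
        also have "\<dots> \<le> ?P N"
          using p0 p1 by (intro prod_unit_interval_antimono initial_indices_mono) auto
        finally show "(\<Prod>i\<in>S. 1 - p (U i \<omega>)) \<le> ?P N" .
      qed
    qed
    also have "(\<Prod>i\<in>S. 1 - p (U i \<omega>)) = (\<Prod>c\<in>C. \<Prod>i | i \<in> S \<and> p (U i \<omega>) = c. 1 - p (U i \<omega>))"
      using fin_S fin_C by (intro prod.group[symmetric]) (auto simp: S_def C_def)
    also have "\<dots> = (\<Prod>c\<in>C. (1 - c) ^ nat \<lfloor>enn2real (K c \<omega>)\<rfloor>)"
    proof (intro prod.cong refl)
      fix c assume c: "c \<in> C"
      then have "{i. i \<in> S \<and> p (U i \<omega>) = c} = F c" by (auto simp: C_def S_def F_def)
      then have "(\<Prod>i | i \<in> S \<and> p (U i \<omega>) = c. 1 - p (U i \<omega>)) = (\<Prod>i\<in>F c. 1 - c)"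
        by (intro prod.cong) (auto simp: F_def)
      then show "(\<Prod>i | i \<in> S \<and> p (U i \<omega>) = c. 1 - p (U i \<omega>)) = (1 - c) ^ nat \<lfloor>enn2real (K c \<omega>)\<rfloor>"
        by (simp add: K_card[OF c])
    qed
    also have "ennreal \<dots> = (\<Prod>c\<in>C. ennreal ((1 - c) ^ nat \<lfloor>enn2real (K c \<omega>)\<rfloor>))"
      using C by (intro prod_ennreal[symmetric]) auto
    finally show ?thesis .
  qed
  have inj_A: "inj_on A C"
    by (auto simp: inj_on_def A_def C_def vimage_def set_eq_iff)
  have "indep_vars (\<lambda>_. borel) (\<lambda>B. point_count U B) (A ` C)"
  proof -
    have "disjoint (A ` C)" by (auto simp: disjoint_def A_def)
    moreover have "A ` C \<subseteq> {B \<in> sets borel. emeasure \<Lambda> B < \<infinity>}"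
      using A_sets A_fin by blast
    ultimately show ?thesis using poisson_process_indep_counts[OF U] by blast
  qed
  then have "indep_vars (\<lambda>_. borel) (\<lambda>c. point_count U (A c)) C"
    by (rule indep_vars_reindex[where M' = "\<lambda>_. borel" and X = "point_count U", OF _ inj_A])
  then have "indep_vars (\<lambda>_. borel) K C"
    by (simp add: K_def[abs_def])
  then have indep: "indep_vars (\<lambda>_. borel) (\<lambda>c \<omega>. ennreal ((1 - c) ^ nat \<lfloor>enn2real (K c \<omega>)\<rfloor>)) C"
  proof (rule indep_vars_compose2)
    fix c :: real
    have "(\<lambda>x. nat \<lfloor>enn2real x\<rfloor>) \<in> measurable borel (count_space UNIV)" by measurable
    then show "(\<lambda>x. ennreal ((1 - c) ^ nat \<lfloor>enn2real x\<rfloor>)) \<in> borel_measurable borel"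
      by (rule measurable_compose) simp
  qed
  have "(\<integral>\<^sup>+\<omega>. (INF N. ennreal (\<Prod>i\<in>initial_indices N. 1 - p (U i \<omega>))) \<partial>M) =
      (\<integral>\<^sup>+\<omega>. (\<Prod>c\<in>C. ennreal ((1 - c) ^ nat \<lfloor>enn2real (K c \<omega>)\<rfloor>)) \<partial>M)"
  proof (rule nn_integral_cong_AE)
    have "AE \<omega> in M. \<forall>c\<in>C. K c \<omega> < \<infinity>"
      unfolding K_def AE_finite_all[OF fin_C]
      by (intro ballI poisson_process_count_finite[OF \<open>prob_space M\<close> U A_sets A_fin])
    then show "AE \<omega> in M. (INF N. ennreal (\<Prod>i\<in>initial_indices N. 1 - p (U i \<omega>))) =
        (\<Prod>c\<in>C. ennreal ((1 - c) ^ nat \<lfloor>enn2real (K c \<omega>)\<rfloor>))"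
      by eventually_elim (rule prod_eq)
  qed
  also have "\<dots> = (\<Prod>c\<in>C. \<integral>\<^sup>+\<omega>. ennreal ((1 - c) ^ nat \<lfloor>enn2real (K c \<omega>)\<rfloor>) \<partial>M)"
    using fin_C indep by (intro indep_vars_nn_integral) auto
  also have "\<dots> = (\<Prod>c\<in>C. ennreal (exp (- (c * measure \<Lambda> (A c)))))"
    using C unfolding K_def
    by (intro prod.cong refl, subst poisson_process_count_pgf[OF \<open>prob_space M\<close> U A_sets A_fin]) auto
  also have "\<dots> = ennreal (exp (- (\<Sum>c\<in>C. c * measure \<Lambda> (A c))))"
    by (simp add: prod_ennreal exp_sum[OF fin_C, symmetric] sum_negf)
  finally show ?thesis by (simp add: int_p)
qed

text \<open>
  The general case follows by monotone approximation of \<open>p\<close> from below by simple functions. The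
  infinite products are infima, and the two infima, over the approximation and over the finite
  partial products, may be exchanged.
\<close>

theorem poisson_process_generating_functional:
  fixes U :: "'i::countable \<Rightarrow> 'w \<Rightarrow> 'a::topological_space" and p :: "'a \<Rightarrow> real"
  assumes "prob_space M" and U: "poisson_process M \<Lambda> U" and sets_L: "sets \<Lambda> = sets borel"
    and p[measurable]: "p \<in> borel_measurable borel"
    and p0: "\<And>x. 0 \<le> p x" and p1: "\<And>x. p x \<le> 1"
    and p_int: "(\<integral>\<^sup>+x. ennreal (p x) \<partial>\<Lambda>) < \<infinity>"
  shows "(\<integral>\<^sup>+\<omega>. (INF N. ennreal (\<Prod>i\<in>initial_indices N. 1 - p (U i \<omega>))) \<partial>M) =
    ennreal (exp (- enn2real (\<integral>\<^sup>+x. ennreal (p x) \<partial>\<Lambda>)))"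
proof -
  interpret prob_space M by fact
  have [measurable]: "U i \<in> borel_measurable M" for i
    using U by (auto simp: poisson_process_def)
  obtain f where inc: "incseq f" and simple: "\<And>n. simple_function borel (f n)"
    and bdd: "\<And>x. bdd_above (range (\<lambda>n. f n x))" and f0: "\<And>n x. 0 \<le> f n x" and "p = (SUP n. f n)"
    using borel_measurable_implies_simple_function_sequence_real[OF p p0] by metis
  have inc_x: "incseq (\<lambda>n. f n x)" for x
    using inc by (simp add: incseq_def le_fun_def)
  have lim: "(\<lambda>n. f n x) \<longlonglongrightarrow> p x" for x
    unfolding \<open>p = (SUP n. f n)\<close> SUP_apply by (rule LIMSEQ_incseq_SUP[OF bdd inc_x])
  have f_le: "f n x \<le> p x" for n x
    by (rule incseq_le[OF inc_x lim])
  have f1: "f n x \<le> 1" for n x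
    using f_le[of n x] p1[of x] by simp
  have f_meas[measurable]: "f n \<in> borel_measurable borel" for n
    by (rule borel_measurable_simple_function[OF simple])
  have L_meas: "g \<in> borel_measurable \<Lambda>" if "g \<in> borel_measurable borel" for g :: "'a \<Rightarrow> ennreal"
    using that sets_L by (simp cong: measurable_cong_sets)
  have int_le: "(\<integral>\<^sup>+x. ennreal (f n x) \<partial>\<Lambda>) \<le> (\<integral>\<^sup>+x. ennreal (p x) \<partial>\<Lambda>)" for n
    using f_le by (intro nn_integral_mono ennreal_leI)
  define G where "G g \<omega> = (INF N. ennreal (\<Prod>i\<in>initial_indices N. 1 - g (U i \<omega>)))"
    for g :: "'a \<Rightarrow> real" and \<omega>
  have G_meas: "G (f n) \<in> borel_measurable M" for n
    unfolding G_def by measurable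
  have int_G: "(\<integral>\<^sup>+\<omega>. G (f n) \<omega> \<partial>M) = ennreal (exp (- enn2real (\<integral>\<^sup>+x. ennreal (f n x) \<partial>\<Lambda>)))" for n
    unfolding G_def
    using simple_functionD(1)[OF simple[of n]] f0 f1 le_less_trans[OF int_le p_int]
    by (intro poisson_process_generating_functional_simple assms(1) U sets_L f_meas) auto
  have dec: "decseq (\<lambda>n. G (f n))"
    unfolding G_def using f1 incseq_SucD[OF inc_x]
    by (intro decseq_SucI le_funI INF_mono' ennreal_leI prod_mono) (auto intro: diff_left_mono)
  have "(INF n. G (f n) \<omega>) = G p \<omega>" for \<omega>
  proof -
    have "(INF n. ennreal (\<Prod>i\<in>initial_indices N. 1 - f n (U i \<omega>))) =
        ennreal (\<Prod>i\<in>initial_indices N. 1 - p (U i \<omega>))" for N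
    proof (rule LIMSEQ_unique[OF LIMSEQ_INF])
      show "decseq (\<lambda>n. ennreal (\<Prod>i\<in>initial_indices N. 1 - f n (U i \<omega>)))"
        using f1 incseq_SucD[OF inc_x]
        by (intro decseq_SucI ennreal_leI prod_mono) (auto intro: diff_left_mono)
      show "(\<lambda>n. ennreal (\<Prod>i\<in>initial_indices N. 1 - f n (U i \<omega>)))
          \<longlonglongrightarrow> ennreal (\<Prod>i\<in>initial_indices N. 1 - p (U i \<omega>))"
        by (intro tendsto_ennrealI tendsto_prod tendsto_diff tendsto_const lim)
    qed
    then show ?thesis
      unfolding G_def by (subst INF_commute) simp
  qed
  then have "(\<integral>\<^sup>+\<omega>. G p \<omega> \<partial>M) = (\<integral>\<^sup>+\<omega>. (INF n. G (f n) \<omega>) \<partial>M)" by simp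
  also have "\<dots> = (INF n. \<integral>\<^sup>+\<omega>. G (f n) \<omega> \<partial>M)"
    using G_meas by (intro nn_integral_monotone_convergence_INF_decseq[OF dec, of _ 0]) (auto simp: int_G)
  also have "\<dots> = ennreal (exp (- enn2real (\<integral>\<^sup>+x. ennreal (p x) \<partial>\<Lambda>)))"
  proof (rule LIMSEQ_unique[OF LIMSEQ_INF])
    show "decseq (\<lambda>n. \<integral>\<^sup>+\<omega>. G (f n) \<omega> \<partial>M)"
      using le_funD[OF decseq_SucD[OF dec]] by (intro decseq_SucI nn_integral_mono)
    have "(\<lambda>n. \<integral>\<^sup>+x. ennreal (f n x) \<partial>\<Lambda>) \<longlonglongrightarrow> (\<integral>\<^sup>+x. ennreal (p x) \<partial>\<Lambda>)"
      using inc lim by (intro nn_integral_LIMSEQ L_meas)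
        (auto simp: incseq_def le_fun_def intro!: ennreal_leI tendsto_ennrealI)
    then have "(\<lambda>n. enn2real (\<integral>\<^sup>+x. ennreal (f n x) \<partial>\<Lambda>)) \<longlonglongrightarrow> enn2real (\<integral>\<^sup>+x. ennreal (p x) \<partial>\<Lambda>)"
      using p_int by (intro tendsto_enn2real) (auto simp: ennreal_enn2real_if)
    then show "(\<lambda>n. \<integral>\<^sup>+\<omega>. G (f n) \<omega> \<partial>M) \<longlonglongrightarrow> ennreal (exp (- enn2real (\<integral>\<^sup>+x. ennreal (p x) \<partial>\<Lambda>)))"
      unfolding int_G by (intro tendsto_ennrealI tendsto_exp tendsto_minus)
  qed
  finally show ?thesis by (simp add: G_def)
qed

section \<open>Volume covered by random balls\<close>

text \<open>
  A point \<open>u\<close> belongs to the union iff adding \<open>\<xi> t\<close> brings it within distance less than \<open>x t\<close>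
  of the origin for some \<open>t\<close>. The balls for nonpositive levels are empty.
\<close>

definition expected_hit_volume ::
  "'v measure \<Rightarrow> ('t \<Rightarrow> 'v \<Rightarrow> 'a::euclidean_space) \<Rightarrow> 't set \<Rightarrow> ('t \<Rightarrow> real) \<Rightarrow> ennreal" where
  "expected_hit_volume N \<xi> J x = (\<integral>\<^sup>+\<omega>. emeasure lborel (\<Union>t\<in>J. ball (- \<xi> t \<omega>) (x t)) \<partial>N)"

lemma emeasure_lborel_translate:
  fixes c :: "'a::euclidean_space"
  assumes "A \<in> sets borel"
  shows "emeasure lborel ((+) c -` A) = emeasure lborel A"
  using emeasure_distr[of "(+) c" lborel borel A] assms by (simp add: lborel_distr_plus)

lemma emeasure_lborel_ball_translate:
  fixes c :: "'a::euclidean_space"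
  shows "emeasure lborel (ball c r) = emeasure lborel (ball (0::'a) r)"
proof -
  have "(+) c -` ball c r = ball 0 r" by (auto simp: dist_norm)
  then show ?thesis using emeasure_lborel_translate[of "ball c r" c] by simp
qed

lemma hit_volume_measurable:
  fixes x :: "'t \<Rightarrow> real"
  assumes "finite J"
  shows "(\<lambda>y. emeasure lborel (\<Union>t\<in>J. ball (- y t) (x t))) \<in>
    borel_measurable (PiM J (\<lambda>_. borel :: 'a::euclidean_space measure))"
proof (rule lborel.measurable_emeasure)
  let ?P = "PiM J (\<lambda>_. borel :: 'a measure) \<Otimes>\<^sub>M lborel"
  have "{z \<in> space ?P. \<exists>t\<in>J. norm (snd z + fst z t) < x t} \<in> sets ?P"
  proof (intro sets.sets_Collect_finite_Ex assms)
    fix t assume t: "t \<in> J"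
    have [measurable]: "(\<lambda>z. fst z t) \<in> borel_measurable ?P"
      by (rule measurable_compose[OF measurable_fst measurable_component_singleton[OF t]])
    show "{z \<in> space ?P. norm (snd z + fst z t) < x t} \<in> sets ?P"
      by measurable
  qed
  moreover have "dist (- y) u = norm (u + y)" for u y :: 'a
    by (metis dist_commute dist_norm diff_minus_eq_add)
  ultimately show "{z \<in> space ?P. snd z \<in> (\<Union>t\<in>J. ball (- fst z t) (x t))} \<in> sets ?P"
    by simp
qed simp

lemma expected_hit_volume_finite:
  fixes \<xi> :: "'t \<Rightarrow> 'v \<Rightarrow> 'a::euclidean_space"
  assumes "prob_space N" "finite J"
  shows "expected_hit_volume N \<xi> J x < \<infinity>"
proof -
  interpret prob_space N by fact
  have "expected_hit_volume N \<xi> J x \<le> (\<integral>\<^sup>+\<omega>. (\<Sum>t\<in>J. emeasure lborel (ball (0::'a) (x t))) \<partial>N)"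
    unfolding expected_hit_volume_def
  proof (rule nn_integral_mono)
    fix \<omega>
    have "emeasure lborel (\<Union>t\<in>J. ball (- \<xi> t \<omega>) (x t)) \<le>
        (\<Sum>t\<in>J. emeasure lborel (ball (- \<xi> t \<omega>) (x t)))"
      using assms(2) by (intro emeasure_subadditive_finite) auto
    also have "\<dots> = (\<Sum>t\<in>J. emeasure lborel (ball (0::'a) (x t)))"
      by (intro sum.cong refl emeasure_lborel_ball_translate)
    finally show "emeasure lborel (\<Union>t\<in>J. ball (- \<xi> t \<omega>) (x t)) \<le>
        (\<Sum>t\<in>J. emeasure lborel (ball (0::'a) (x t)))" .
  qed
  also have "\<dots> = (\<Sum>t\<in>J. emeasure lborel (ball (0::'a) (x t)))"
    by (simp add: emeasure_space_1)
  also have "\<dots> < \<infinity>"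
    using assms(2) emeasure_lborel_ball_finite[of "0::'a"] by simp
  finally show ?thesis .
qed

text \<open>
  Translating all the balls of a union by the same vector \<open>\<xi> h\<close> keeps its volume, so only
  \<open>\<xi> (t + h) - \<xi> h\<close> matters, and its law does not depend on \<open>h\<close>.
\<close>

lemma expected_hit_volume_shift:
  fixes \<xi> :: "'t::ab_group_add \<Rightarrow> 'v \<Rightarrow> 'a::euclidean_space"
  assumes "stationary_increments N \<xi>" and J: "finite J"
  shows "expected_hit_volume N (\<lambda>t. \<xi> (t + h)) J x = expected_hit_volume N \<xi> J x"
proof -
  let ?P = "PiM J (\<lambda>_. borel :: 'a measure)"
  define V where "V y = emeasure lborel (\<Union>t\<in>J. ball (- y t) (x t))" for y :: "'t \<Rightarrow> 'a"
  have V_meas: "V \<in> borel_measurable ?P"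
    using hit_volume_measurable[OF J, of x] by (simp add: V_def[abs_def])
  have V_translate: "V (\<lambda>t\<in>J. y t - c) = V y" for y c
  proof -
    have "dist (c - y t) (c + u) = dist (- y t) u" for t u
      unfolding dist_norm by (rule arg_cong[where f = norm]) (simp add: algebra_simps)
    then have "(+) c -` (\<Union>t\<in>J. ball (- (y t - c)) (x t)) = (\<Union>t\<in>J. ball (- y t) (x t))"
      by auto
    then have "V y = V (\<lambda>t. y t - c)"
      using emeasure_lborel_translate[OF borel_open[OF open_UN[of J "\<lambda>t. ball (- (y t - c)) (x t)"]], of c]
      by (simp add: V_def)
    then show ?thesis by (simp add: V_def)
  qed
  have meas: "\<xi> t \<in> borel_measurable N" for t
    using assms(1) by (auto simp: stationary_increments_def random_field_def)
  \<comment> \<open>Used for \<open>k = h\<close> and for \<open>k = 0\<close>.\<close>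
  have incr: "(\<integral>\<^sup>+\<omega>. V (\<lambda>t. \<xi> (t + k) \<omega>) \<partial>N) =
      (\<integral>\<^sup>+y. V y \<partial>distr N ?P (\<lambda>\<omega>. \<lambda>t\<in>J. \<xi> (t + k) \<omega> - \<xi> k \<omega>))" for k
    using V_meas meas
    by (subst nn_integral_distr) (auto simp: V_translate intro!: measurable_restrict)
  have "distr N ?P (\<lambda>\<omega>. \<lambda>t\<in>J. \<xi> (t + h) \<omega> - \<xi> h \<omega>) = distr N ?P (\<lambda>\<omega>. \<lambda>t\<in>J. \<xi> t \<omega> - \<xi> 0 \<omega>)"
    using assms by (simp add: stationary_increments_def same_fdd_def)
  then show ?thesis
    using incr[of h] incr[of 0] by (simp add: expected_hit_volume_def V_def)
qed

section \<open>Poisson points displaced by independent fields\<close>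

text \<open>
  Dilating the points preserves these hypotheses with the same marks at a changed rate, so every
  result about the process built from the points also holds for the one built from dilated points.
\<close>

locale displaced_poisson =
  M: prob_space M + N: prob_space N
  for M :: "'w measure" and N :: "'v measure" +
  fixes r :: real
    and U :: "'i::countable \<Rightarrow> 'w \<Rightarrow> 'a::euclidean_space"
    and \<xi> :: "'t \<Rightarrow> 'v \<Rightarrow> 'a"
    and \<xi>' :: "'i \<Rightarrow> 't \<Rightarrow> 'w \<Rightarrow> 'a"
  assumes rate_nonneg: "0 \<le> r"
    and poisson: "poisson_process M (scale_measure (ennreal r) lborel) U"
    and field: "random_field N \<xi>"
    and fields: "\<And>i. random_field M (\<xi>' i)"
    and same: "\<And>i. same_fdd M (\<xi>' i) N \<xi>"
    and indep_copies: "M.indep_vars (\<lambda>_. PiM UNIV (\<lambda>_. borel)) (\<lambda>i \<omega> t. \<xi>' i t \<omega>) UNIV"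
    and indep_points: "M.indep_set (field_sigma M U) (field_sigma M (\<lambda>(i, t). \<xi>' i t))"
begin

definition mark_law :: "'t set \<Rightarrow> ('t \<Rightarrow> 'a) measure" where
  "mark_law J = distr N (PiM J (\<lambda>_. borel)) (\<lambda>\<omega>. \<lambda>t\<in>J. \<xi> t \<omega>)"

definition nearest :: "'t \<Rightarrow> 'w \<Rightarrow> real" where
  "nearest t \<omega> = (INF i. norm (U i \<omega> + \<xi>' i t \<omega>))"

lemma sets_mark_law [simp, measurable_cong]: "sets (mark_law J) = sets (PiM J (\<lambda>_. borel))"
  by (simp add: mark_law_def)

lemma space_mark_law: "space (mark_law J) = J \<rightarrow>\<^sub>E UNIV"
  by (simp add: mark_law_def space_PiM)

lemma prob_space_mark_law: "prob_space (mark_law J)"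
  unfolding mark_law_def by (intro N.prob_space_distr random_field_restrict_measurable field)

lemma U_measurable [measurable]: "U i \<in> borel_measurable M"
  using poisson by (auto simp: poisson_process_def)

lemma \<xi>_measurable [measurable]: "\<xi> t \<in> borel_measurable N"
  using field by (auto simp: random_field_def)

lemma \<xi>'_measurable [measurable]: "\<xi>' i t \<in> borel_measurable M"
  using fields by (auto simp: random_field_def)

text \<open>
  The points and the marks with indices in \<open>F\<close> have a product law, the marks having the product
  of their common law. Tonelli's theorem therefore integrates the marks first, one factor for each
  index.
\<close>

lemma integrate_out_marks:
  fixes f :: "'a \<times> ('t \<Rightarrow> 'a) \<Rightarrow> ennreal"
  assumes F: "finite F" and J: "finite J"
    and f: "f \<in> borel_measurable (borel \<Otimes>\<^sub>M PiM J (\<lambda>_. borel))"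
  shows "(\<integral>\<^sup>+\<omega>. (\<Prod>i\<in>F. f (U i \<omega>, \<lambda>t\<in>J. \<xi>' i t \<omega>)) \<partial>M) =
    (\<integral>\<^sup>+\<omega>. (\<Prod>i\<in>F. \<integral>\<^sup>+y. f (U i \<omega>, y) \<partial>mark_law J) \<partial>M)"
proof (cases "F = {}")
  case False
  interpret L: prob_space "mark_law J" by (rule prob_space_mark_law)
  interpret LP: product_sigma_finite "\<lambda>_::'i. mark_law J" ..
  let ?PJ = "PiM J (\<lambda>_. borel :: 'a measure)"
  let ?S = "PiM F (\<lambda>_. borel :: 'a measure)" and ?T = "PiM F (\<lambda>_. ?PJ)"
  define u where "u \<omega> = (\<lambda>i\<in>F. U i \<omega>)" for \<omega>
  define y where "y \<omega> = (\<lambda>i\<in>F. \<lambda>t\<in>J. \<xi>' i t \<omega>)" for \<omega>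
  have u: "u \<in> measurable M ?S"
    unfolding u_def by measurable
  have y: "y \<in> measurable M ?T"
    unfolding y_def by measurable
  have "(\<lambda>v. \<lambda>i\<in>F. v i) \<in> measurable (PiM UNIV (\<lambda>_. borel)) ?S"
    by measurable
  from vimage_in_field_sigma[OF this, of _ U M]
  have u_sigma: "u -` A \<inter> space M \<in> field_sigma M U" if "A \<in> sets ?S" for A
    using that by (simp add: u_def[abs_def])
  have "(\<lambda>v. \<lambda>i\<in>F. \<lambda>t\<in>J. v (i, t)) \<in> measurable (PiM UNIV (\<lambda>_. borel)) ?T"
    by measurable
  from vimage_in_field_sigma[OF this, of _ "\<lambda>(i, t). \<xi>' i t" M]
  have y_sigma: "y -` B \<inter> space M \<in> field_sigma M (\<lambda>(i, t). \<xi>' i t)" if "B \<in> sets ?T" for B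
    using that by (simp add: y_def[abs_def])
  have joint: "distr M ?S u \<Otimes>\<^sub>M distr M ?T y = distr M (?S \<Otimes>\<^sub>M ?T) (\<lambda>\<omega>. (u \<omega>, y \<omega>))"
    using M.distr_pair_if_indep_set[OF u y indep_points] u_sigma y_sigma by blast
  have "M.indep_vars (\<lambda>_. ?PJ) (\<lambda>i \<omega>. \<lambda>t\<in>J. \<xi>' i t \<omega>) F"
    using M.indep_vars_compose2[OF M.indep_vars_subset[OF indep_copies],
        of F "\<lambda>_ v. \<lambda>t\<in>J. v t" "\<lambda>_. ?PJ"] by simp
  then have "distr M ?T y = PiM F (\<lambda>i. distr M ?PJ (\<lambda>\<omega>. \<lambda>t\<in>J. \<xi>' i t \<omega>))"
    unfolding y_def
    by (subst (asm) M.indep_vars_iff_distr_eq_PiM'[OF False]) (auto intro!: measurable_restrict)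
  also have "\<dots> = PiM F (\<lambda>_. mark_law J)"
    using same J by (simp add: same_fdd_def mark_law_def)
  finally have law_y: "distr M ?T y = PiM F (\<lambda>_. mark_law J)" .
  interpret PF: prob_space "PiM F (\<lambda>_. mark_law J)"
    by (intro prob_space_PiM prob_space_mark_law)
  define g where "g z = (\<Prod>i\<in>F. f (fst z i, snd z i))" for z
  have g_ST: "g \<in> borel_measurable (?S \<Otimes>\<^sub>M ?T)"
    unfolding g_def
  proof (intro borel_measurable_prod_ennreal)
    fix i assume "i \<in> F"
    then have "(\<lambda>z. (fst z i, snd z i)) \<in> measurable (?S \<Otimes>\<^sub>M ?T) (borel \<Otimes>\<^sub>M ?PJ)"
      by (intro measurable_Pair measurable_compose[OF measurable_fst]
          measurable_compose[OF measurable_snd] measurable_component_singleton)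
    then show "(\<lambda>z. f (fst z i, snd z i)) \<in> borel_measurable (?S \<Otimes>\<^sub>M ?T)"
      by (rule measurable_compose[OF _ f])
  qed
  have sets_T: "sets (PiM F (\<lambda>_. mark_law J)) = sets ?T"
    by (intro sets_PiM_cong) auto
  have g: "g \<in> borel_measurable (distr M ?S u \<Otimes>\<^sub>M PiM F (\<lambda>_. mark_law J))"
    using g_ST by (subst measurable_cong_sets[OF sets_pair_measure_cong[OF sets_distr sets_T] refl])
  have f_u: "(\<lambda>y. f (x, y)) \<in> borel_measurable (mark_law J)" for x
    using f by measurable
  have f_int: "(\<lambda>x. \<integral>\<^sup>+y. f (x, y) \<partial>mark_law J) \<in> borel_measurable borel"
    using f by measurable
  have int_meas: "(\<lambda>a. \<Prod>i\<in>F. \<integral>\<^sup>+y. f (a i, y) \<partial>mark_law J) \<in> borel_measurable ?S"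
  proof (intro borel_measurable_prod_ennreal)
    fix i assume "i \<in> F"
    then have "(\<lambda>a. a i) \<in> measurable ?S borel" by (rule measurable_component_singleton)
    then show "(\<lambda>a. \<integral>\<^sup>+y. f (a i, y) \<partial>mark_law J) \<in> borel_measurable ?S"
      by (rule measurable_compose[OF _ f_int])
  qed
  have "(\<integral>\<^sup>+\<omega>. (\<Prod>i\<in>F. f (U i \<omega>, \<lambda>t\<in>J. \<xi>' i t \<omega>)) \<partial>M) = (\<integral>\<^sup>+\<omega>. g (u \<omega>, y \<omega>) \<partial>M)"
    by (simp add: g_def u_def y_def)
  also have "\<dots> = (\<integral>\<^sup>+z. g z \<partial>distr M (?S \<Otimes>\<^sub>M ?T) (\<lambda>\<omega>. (u \<omega>, y \<omega>)))"
    using u y g_ST by (subst nn_integral_distr) auto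
  also have "\<dots> = (\<integral>\<^sup>+z. g z \<partial>(distr M ?S u \<Otimes>\<^sub>M PiM F (\<lambda>_. mark_law J)))"
    by (simp only: joint[symmetric] law_y)
  also have "\<dots> = (\<integral>\<^sup>+a. \<integral>\<^sup>+b. g (a, b) \<partial>PiM F (\<lambda>_. mark_law J) \<partial>distr M ?S u)"
    by (rule PF.nn_integral_fst[symmetric, OF g])
  also have "\<dots> = (\<integral>\<^sup>+a. (\<Prod>i\<in>F. \<integral>\<^sup>+y. f (a i, y) \<partial>mark_law J) \<partial>distr M ?S u)"
    unfolding g_def fst_conv snd_conv
    by (intro nn_integral_cong LP.product_nn_integral_prod F f_u)
  also have "\<dots> = (\<integral>\<^sup>+\<omega>. (\<Prod>i\<in>F. \<integral>\<^sup>+y. f (u \<omega> i, y) \<partial>mark_law J) \<partial>M)"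
    by (rule nn_integral_distr[OF u]) (use int_meas in simp)
  finally show ?thesis by (simp add: u_def)
qed simp

end

section \<open>Attainment of the minimum\<close>

lemma INF_attained_if_finite_sublevels:
  fixes a :: "'i \<Rightarrow> real"
  assumes fin: "\<And>n::nat. finite {i. a i < real n}"
  shows "\<exists>i. (INF i. a i) = a i"
proof -
  fix i0 :: 'i
  obtain n :: nat where n: "a i0 < real n" using reals_Archimedean2 by blast
  let ?S = "{i. a i < real n}"
  have "finite (a ` ?S)" "a ` ?S \<noteq> {}" using fin n by auto
  then have "Min (a ` ?S) \<in> a ` ?S" by (rule Min_in)
  then obtain m where m: "m \<in> ?S" "Min (a ` ?S) = a m" by auto
  have "a m \<le> a i" for i
  proof (cases "i \<in> ?S")
    case True
    then show ?thesis using fin by (simp add: m(2)[symmetric])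
  next
    case False
    then show ?thesis using m(1) by simp
  qed
  then have "(INF i. a i) = a m"
    by (intro cInf_eq_minimum) auto
  then show ?thesis ..
qed

context displaced_poisson
begin

lemma nearest_measurable [measurable]: "nearest t \<in> borel_measurable M"
  unfolding nearest_def[abs_def] by measurable

lemma le_nearest_iff: "x \<le> nearest t \<omega> \<longleftrightarrow> (\<forall>i. x \<le> norm (U i \<omega> + \<xi>' i t \<omega>))"
proof -
  have "bdd_below (range (\<lambda>i. norm (U i \<omega> + \<xi>' i t \<omega>)))"
    by (intro bdd_belowI[of _ 0]) auto
  then show ?thesis by (simp add: nearest_def le_cINF_iff)
qed

lemma displaced_component_measurable:
  assumes "t \<in> J"
  shows "(\<lambda>z. norm (fst z + snd z t)) \<in> borel_measurable (borel \<Otimes>\<^sub>M PiM J (\<lambda>_. borel :: 'a measure))"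
proof -
  have [measurable]: "(\<lambda>z. snd z t) \<in> borel_measurable (borel \<Otimes>\<^sub>M PiM J (\<lambda>_. borel))"
    by (rule measurable_compose[OF measurable_snd measurable_component_singleton[OF assms]])
  show ?thesis by measurable
qed

text \<open>
  The expected number of displaced points \<open>U i + \<xi>' i t\<close> in a ball about the origin can be computed by
  freezing the mark: for a fixed displacement \<open>y\<close>, the points that \<open>y\<close> moves into the ball
  are those in the ball translated by \<open>- y\<close>, and their mean number is the rate times its volume.
  This does not depend on \<open>y\<close>.
\<close>

lemma locally_finite:
  "AE \<omega> in M. \<forall>n::nat. finite {i. norm (U i \<omega> + \<xi>' i t \<omega>) < real n}"
  unfolding AE_all_countable
proof
  fix n :: nat
  let ?R = "real n"
  let ?P = "PiM {t} (\<lambda>_. borel :: 'a measure)"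
  interpret L: prob_space "mark_law {t}" by (rule prob_space_mark_law)
  interpret W: pair_sigma_finite M "mark_law {t}" ..
  define f :: "'a \<times> ('t \<Rightarrow> 'a) \<Rightarrow> ennreal" where
    "f = (\<lambda>z. indicator {..<?R} (norm (fst z + snd z t)))"
  have f: "f \<in> borel_measurable (borel \<Otimes>\<^sub>M ?P)"
    unfolding f_def by (intro measurable_compose[OF displaced_component_measurable]) auto
  have f_U: "(\<lambda>(\<omega>, y). f (U i \<omega>, y)) \<in> borel_measurable (M \<Otimes>\<^sub>M mark_law {t})" for i
    using f by measurable
  have f_Uy: "(\<lambda>\<omega>. f (U i \<omega>, y)) \<in> borel_measurable M" if "y \<in> space (mark_law {t})" for i y
  proof -
    have "y \<in> space ?P" using that by (simp add: space_mark_law space_PiM)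
    then show ?thesis using f by measurable
  qed
  have f_int: "(\<lambda>y. \<integral>\<^sup>+\<omega>. f (U i \<omega>, y) \<partial>M) \<in> borel_measurable (mark_law {t})" for i
    using f by measurable
  define D where "D \<omega> = {i. norm (U i \<omega> + \<xi>' i t \<omega>) < ?R}" for \<omega>
  have D_ind: "f (U i \<omega>, \<lambda>t\<in>{t}. \<xi>' i t \<omega>) = indicator (D \<omega>) i" for i \<omega>
    by (auto simp: f_def D_def indicator_def)
  have D_meas: "(\<lambda>\<omega>. f (U i \<omega>, \<lambda>t\<in>{t}. \<xi>' i t \<omega>)) \<in> borel_measurable M" for i
    by (rule measurable_compose[OF _ f]) measurable
  have ball_vol: "(\<integral>\<^sup>+\<omega>. \<integral>\<^sup>+i. f (U i \<omega>, y) \<partial>count_space UNIV \<partial>M) =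
      ennreal r * emeasure lborel (ball (0::'a) ?R)" for y
  proof -
    have "(\<integral>\<^sup>+i. f (U i \<omega>, y) \<partial>count_space UNIV) = point_count U (ball (- y t) ?R) \<omega>" for \<omega>
    proof -
      have "f (U i \<omega>, y) = indicator {i. U i \<omega> \<in> ball (- y t) ?R} i" for i
        by (auto simp: f_def indicator_def dist_norm norm_minus_commute[of "- y t"])
      then show ?thesis by (simp add: point_count_def)
    qed
    moreover have "(\<integral>\<^sup>+\<omega>. point_count U (ball (- y t) ?R) \<omega> \<partial>M) =
        emeasure (scale_measure (ennreal r) lborel) (ball (- y t) ?R)"
      using emeasure_lborel_ball_finite[of "- y t" ?R]
      by (intro poisson_process_mean_count[OF M.prob_space_axioms poisson])
        (auto simp: ennreal_mult_less_top)
    ultimately show ?thesis by (simp add: emeasure_ball)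
  qed
  have "(\<integral>\<^sup>+\<omega>. emeasure (count_space UNIV) (D \<omega>) \<partial>M) =
      (\<integral>\<^sup>+\<omega>. \<integral>\<^sup>+i. f (U i \<omega>, \<lambda>t\<in>{t}. \<xi>' i t \<omega>) \<partial>count_space UNIV \<partial>M)"
    unfolding D_ind by simp
  also have "\<dots> = (\<integral>\<^sup>+i. \<integral>\<^sup>+\<omega>. f (U i \<omega>, \<lambda>t\<in>{t}. \<xi>' i t \<omega>) \<partial>M \<partial>count_space UNIV)"
    using D_meas by (intro nn_integral_count_space_nn_integral) auto
  also have "\<dots> = (\<integral>\<^sup>+i. \<integral>\<^sup>+\<omega>. \<integral>\<^sup>+y. f (U i \<omega>, y) \<partial>mark_law {t} \<partial>M \<partial>count_space UNIV)"
    using integrate_out_marks[OF _ _ f, of "{i}" for i] by simp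
  also have "\<dots> = (\<integral>\<^sup>+i. \<integral>\<^sup>+y. \<integral>\<^sup>+\<omega>. f (U i \<omega>, y) \<partial>M \<partial>mark_law {t} \<partial>count_space UNIV)"
    by (intro nn_integral_cong W.Fubini'[symmetric] f_U)
  also have "\<dots> = (\<integral>\<^sup>+y. \<integral>\<^sup>+i. \<integral>\<^sup>+\<omega>. f (U i \<omega>, y) \<partial>M \<partial>count_space UNIV \<partial>mark_law {t})"
    using f_int by (intro nn_integral_count_space_nn_integral[symmetric]) auto
  also have "\<dots> = (\<integral>\<^sup>+y. \<integral>\<^sup>+\<omega>. \<integral>\<^sup>+i. f (U i \<omega>, y) \<partial>count_space UNIV \<partial>M \<partial>mark_law {t})"
    using f_Uy by (intro nn_integral_cong nn_integral_count_space_nn_integral[symmetric]) auto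
  also have "\<dots> = ennreal r * emeasure lborel (ball (0::'a) ?R)"
    unfolding ball_vol by (simp add: L.emeasure_space_1)
  also have "\<dots> < \<infinity>"
    using emeasure_lborel_ball_finite[of "0::'a" ?R] by (simp add: ennreal_mult_less_top)
  finally have "(\<integral>\<^sup>+\<omega>. emeasure (count_space UNIV) (D \<omega>) \<partial>M) \<noteq> \<infinity>" by simp
  moreover have "(\<lambda>\<omega>. emeasure (count_space UNIV) (D \<omega>)) \<in> borel_measurable M"
  proof -
    have "(\<lambda>(i, \<omega>). f (U i \<omega>, \<lambda>t\<in>{t}. \<xi>' i t \<omega>)) \<in> borel_measurable (count_space UNIV \<Otimes>\<^sub>M M)"
      using D_meas by (intro measurable_pair_measure_countable1) auto
    from measurable_pair_swap[OF this]
    have "(\<lambda>(\<omega>, i). f (U i \<omega>, \<lambda>t\<in>{t}. \<xi>' i t \<omega>)) \<in> borel_measurable (M \<Otimes>\<^sub>M count_space UNIV)"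
      by simp
    then have "(\<lambda>\<omega>. \<integral>\<^sup>+i. f (U i \<omega>, \<lambda>t\<in>{t}. \<xi>' i t \<omega>) \<partial>count_space UNIV) \<in> borel_measurable M"
      by (intro sigma_finite_measure.borel_measurable_nn_integral
          sigma_finite_measure_count_space_countable) auto
    then show ?thesis unfolding D_ind by simp
  qed
  ultimately have "AE \<omega> in M. emeasure (count_space UNIV) (D \<omega>) \<noteq> \<infinity>"
    by (intro nn_integral_PInf_AE)
  then show "AE \<omega> in M. finite {i. norm (U i \<omega> + \<xi>' i t \<omega>) < ?R}"
    by eventually_elim (auto simp: D_def emeasure_count_space split: if_splits)
qed

lemma nearest_attained: "AE \<omega> in M. \<exists>i. nearest t \<omega> = norm (U i \<omega> + \<xi>' i t \<omega>)"
  using locally_finite[of t]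
proof eventually_elim
  case (elim \<omega>)
  then show ?case unfolding nearest_def by (intro INF_attained_if_finite_sublevels) blast
qed

section \<open>Void probabilities\<close>

text \<open>
  The partial events \<open>E n\<close> involve finitely many points, so their probabilities are the
  expectations of finite products of \<open>1 - p (U i)\<close>, by integrating out the marks. Letting \<open>n\<close>
  tend to infinity yields the generating functional at \<open>p\<close>, and exchanging the order of integration in
  \<open>\<integral> p\<close> turns the section over marks into the section over points, which is a union of balls.
\<close>

theorem void_probability:
  assumes J: "finite J"
  shows "measure M {\<omega> \<in> space M. \<forall>t\<in>J. x t \<le> nearest t \<omega>} =
    exp (- (r * enn2real (expected_hit_volume N \<xi> J x)))"
proof -
  let ?P = "PiM J (\<lambda>_. borel :: 'a measure)"
  interpret L: prob_space "mark_law J" by (rule prob_space_mark_law)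
  interpret W: pair_sigma_finite "lborel :: 'a measure" "mark_law J" ..
  \<comment> \<open>The forbidden region for a marked point; \<open>p u\<close> is the probability that a point at \<open>u\<close> falls into it.\<close>
  define H where "H = {z \<in> space (borel \<Otimes>\<^sub>M ?P). \<exists>t\<in>J. norm (fst z + snd z t) < x t}"
  define p where "p u = measure (mark_law J) (Pair u -` H)" for u
  have H: "H \<in> sets (borel \<Otimes>\<^sub>M ?P)"
    unfolding H_def
  proof (intro sets.sets_Collect_finite_Ex J)
    fix t assume "t \<in> J"
    note [measurable] = displaced_component_measurable[OF this]
    show "{z \<in> space (borel \<Otimes>\<^sub>M ?P). norm (fst z + snd z t) < x t} \<in> sets (borel \<Otimes>\<^sub>M ?P)"
      by measurable
  qed
  have H': "H \<in> sets (borel \<Otimes>\<^sub>M mark_law J)" "H \<in> sets (lborel \<Otimes>\<^sub>M mark_law J)"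
    using H by (simp_all cong: sets_pair_measure_cong)
  have H_section: "Pair u -` H \<in> sets (mark_law J)" for u
    using H'(1) by (rule sets_Pair1)
  have H_iff: "(u, \<lambda>t\<in>J. y t) \<in> H \<longleftrightarrow> (\<exists>t\<in>J. norm (u + y t) < x t)" for u y
    by (auto simp: H_def space_pair_measure space_PiM)
  have p_meas [measurable]: "p \<in> borel_measurable borel"
    unfolding p_def measure_def using L.measurable_emeasure_Pair[OF H'(1)] by measurable
  have p0: "0 \<le> p u" and p1: "p u \<le> 1" for u
    by (auto simp: p_def)
  have p_emeasure: "ennreal (p u) = emeasure (mark_law J) (Pair u -` H)" for u
    by (simp add: p_def L.emeasure_eq_measure)
  define f :: "'a \<times> ('t \<Rightarrow> 'a) \<Rightarrow> ennreal" where
    "f = indicator (space (borel \<Otimes>\<^sub>M ?P) - H)"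
  have f: "f \<in> borel_measurable (borel \<Otimes>\<^sub>M ?P)"
    unfolding f_def using H by (intro borel_measurable_indicator) auto
  have f_int: "(\<integral>\<^sup>+y. f (u, y) \<partial>mark_law J) = ennreal (1 - p u)" for u
  proof -
    have "(\<integral>\<^sup>+y. f (u, y) \<partial>mark_law J) =
        (\<integral>\<^sup>+y. indicator (space (mark_law J) - Pair u -` H) y \<partial>mark_law J)"
      by (intro nn_integral_cong)
        (auto simp: f_def indicator_def space_pair_measure space_mark_law space_PiM)
    also have "\<dots> = emeasure (mark_law J) (space (mark_law J) - Pair u -` H)"
      using H_section[of u] by (intro nn_integral_indicator sets.compl_sets)
    also have "\<dots> = ennreal (1 - p u)"
      using H_section[of u] by (simp add: L.emeasure_eq_measure L.prob_compl p_def)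
    finally show ?thesis .
  qed

  have int_p: "(\<integral>\<^sup>+u. ennreal (p u) \<partial>scale_measure (ennreal r) lborel) =
      ennreal r * expected_hit_volume N \<xi> J x"
  proof -
    have "(\<integral>\<^sup>+u. ennreal (p u) \<partial>scale_measure (ennreal r) lborel) =
        ennreal r * (\<integral>\<^sup>+u. emeasure (mark_law J) (Pair u -` H) \<partial>lborel)"
      unfolding p_emeasure[symmetric] by (intro nn_integral_scale_measure) simp
    also have "(\<integral>\<^sup>+u. emeasure (mark_law J) (Pair u -` H) \<partial>lborel) =
        emeasure (lborel \<Otimes>\<^sub>M mark_law J) H"
      using H'(2) by (simp add: L.emeasure_pair_measure_alt)
    also have "\<dots> = (\<integral>\<^sup>+y. emeasure lborel ((\<lambda>u. (u, y)) -` H) \<partial>mark_law J)"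
      using H'(2) by (rule W.emeasure_pair_measure_alt2)
    also have "\<dots> = (\<integral>\<^sup>+y. emeasure lborel (\<Union>t\<in>J. ball (- y t) (x t)) \<partial>mark_law J)"
    proof (intro nn_integral_cong arg_cong[where f = "emeasure lborel"])
      fix y assume "y \<in> space (mark_law J)"
      then show "(\<lambda>u. (u, y)) -` H = (\<Union>t\<in>J. ball (- y t) (x t))"
        by (auto simp: H_def space_mark_law space_pair_measure space_PiM dist_norm
            norm_minus_commute[of "- y _"])
    qed
    also have "\<dots> = expected_hit_volume N \<xi> J x"
      unfolding mark_law_def expected_hit_volume_def
      using random_field_restrict_measurable[OF field, of J] hit_volume_measurable[OF J, of x]
      by (subst nn_integral_distr) auto
    finally show ?thesis .
  qed
  have p_int: "(\<integral>\<^sup>+u. ennreal (p u) \<partial>scale_measure (ennreal r) lborel) < \<infinity>"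
    unfolding int_p using expected_hit_volume_finite[OF N.prob_space_axioms J, of \<xi> x]
    by (simp add: ennreal_mult_less_top)

  define E where
    "E n = {\<omega> \<in> space M. \<forall>i\<in>initial_indices n. \<forall>t\<in>J. x t \<le> norm (U i \<omega> + \<xi>' i t \<omega>)}" for n
  have E: "E n \<in> sets M" for n
    unfolding E_def using J by (intro sets.sets_Collect_finite_All finite_initial_indices) measurable
  have "decseq E"
    using initial_indices_mono unfolding decseq_def E_def by blast
  have E_prob: "emeasure M (E n) = (\<integral>\<^sup>+\<omega>. ennreal (\<Prod>i\<in>initial_indices n. 1 - p (U i \<omega>)) \<partial>M)" for n
  proof -
    have "emeasure M (E n) = (\<integral>\<^sup>+\<omega>. indicator (E n) \<omega> \<partial>M)"
      using E by simp
    also have "\<dots> = (\<integral>\<^sup>+\<omega>. (\<Prod>i\<in>initial_indices n. f (U i \<omega>, \<lambda>t\<in>J. \<xi>' i t \<omega>)) \<partial>M)"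
    proof (intro nn_integral_cong)
      fix \<omega> assume "\<omega> \<in> space M"
      have "f (U i \<omega>, \<lambda>t\<in>J. \<xi>' i t \<omega>) = of_bool (\<forall>t\<in>J. x t \<le> norm (U i \<omega> + \<xi>' i t \<omega>))" for i
        by (auto simp: f_def indicator_def H_iff not_less space_pair_measure space_PiM)
      then show "indicator (E n) \<omega> = (\<Prod>i\<in>initial_indices n. f (U i \<omega>, \<lambda>t\<in>J. \<xi>' i t \<omega>))"
        using \<open>\<omega> \<in> space M\<close> by (auto simp: E_def indicator_def prod_zero_iff of_bool_def)
    qed
    also have "\<dots> = (\<integral>\<^sup>+\<omega>. (\<Prod>i\<in>initial_indices n. ennreal (1 - p (U i \<omega>))) \<partial>M)"
      by (subst integrate_out_marks[OF finite_initial_indices J f]) (simp add: f_int)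
    finally show ?thesis
      using p1 by (simp add: prod_ennreal)
  qed
  have "{\<omega> \<in> space M. \<forall>t\<in>J. x t \<le> nearest t \<omega>} = (\<Inter>n. E n)"
    by (fastforce simp: E_def le_nearest_iff initial_indices_def)
  then have "emeasure M {\<omega> \<in> space M. \<forall>t\<in>J. x t \<le> nearest t \<omega>} = (INF n. emeasure M (E n))"
    using E \<open>decseq E\<close> M.emeasure_finite by (subst INF_emeasure_decseq) auto
  also have "\<dots> = (\<integral>\<^sup>+\<omega>. (INF n. ennreal (\<Prod>i\<in>initial_indices n. 1 - p (U i \<omega>))) \<partial>M)"
    unfolding E_prob
  proof (rule nn_integral_monotone_convergence_INF_decseq[symmetric])
    show "decseq (\<lambda>n \<omega>. ennreal (\<Prod>i\<in>initial_indices n. 1 - p (U i \<omega>)))"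
      using p0 p1
      by (intro decseq_SucI le_funI ennreal_leI prod_unit_interval_antimono initial_indices_mono) auto
    show "(\<integral>\<^sup>+\<omega>. ennreal (\<Prod>i\<in>initial_indices 0. 1 - p (U i \<omega>)) \<partial>M) < \<infinity>"
      by (simp add: E_prob[symmetric] M.emeasure_finite less_top[symmetric])
  qed measurable
  also have "\<dots> = ennreal (exp (- enn2real (\<integral>\<^sup>+u. ennreal (p u) \<partial>scale_measure (ennreal r) lborel)))"
    by (intro poisson_process_generating_functional M.prob_space_axioms poisson p_meas p0 p1 p_int) simp
  finally show ?thesis
    using rate_nonneg by (simp add: int_p enn2real_mult M.emeasure_eq_measure)
qed

end

section \<open>Dilation of the points\<close>

lemma emeasure_lborel_vimage_scaleR:
  assumes "0 < c" and A: "A \<in> sets borel"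
  shows "emeasure lborel A = ennreal (c ^ DIM('a)) * emeasure lborel ((\<lambda>x::'a::euclidean_space. c *\<^sub>R x) -` A)"
proof -
  have "emeasure lborel A =
      emeasure (density (distr lborel borel (\<lambda>x::'a. 0 + c *\<^sub>R x)) (\<lambda>_. ennreal (\<bar>c\<bar> ^ DIM('a)))) A"
    using lborel_affine[of c "0::'a"] assms(1) by simp
  also have "\<dots> = ennreal (c ^ DIM('a)) * emeasure lborel ((\<lambda>x. c *\<^sub>R x) -` A)"
    using assms by (simp add: emeasure_density_const emeasure_distr)
  finally show ?thesis .
qed

text \<open>
  Counting dilated points in \<open>A\<close> means counting the original points in the preimage of \<open>A\<close>. Taking
  preimages is injective and preserves disjointness, so independence of the counts carries over, and
  \<open>A\<close> has \<open>c ^ DIM('a)\<close> times the volume of its preimage, which is the divisor of the rate.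
\<close>

lemma poisson_process_scaleR:
  fixes U :: "'i \<Rightarrow> 'w \<Rightarrow> 'a::euclidean_space"
  assumes "prob_space M" and U: "poisson_process M (scale_measure (ennreal r) lborel) U"
    and r: "0 \<le> r" and c: "0 < c"
  shows "poisson_process M (scale_measure (ennreal (r / c ^ DIM('a))) lborel) (\<lambda>i \<omega>. c *\<^sub>R U i \<omega>)"
proof -
  interpret prob_space M by fact
  let ?L = "scale_measure (ennreal r) lborel :: 'a measure"
  let ?L' = "scale_measure (ennreal (r / c ^ DIM('a))) lborel :: 'a measure"
  define pre where "pre A = (\<lambda>x::'a. c *\<^sub>R x) -` A" for A
  have count: "point_count (\<lambda>i \<omega>. c *\<^sub>R U i \<omega>) A = point_count U (pre A)" for A
    by (simp add: fun_eq_iff point_count_def pre_def)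
  have pre_sets: "pre A \<in> sets borel" if "A \<in> sets borel" for A
    unfolding pre_def using measurable_sets[of "\<lambda>x::'a. c *\<^sub>R x" borel borel A] that by simp
  have em: "emeasure ?L' A = emeasure ?L (pre A)" if "A \<in> sets borel" for A
    using c r emeasure_lborel_vimage_scaleR[OF c that]
    by (simp add: pre_def mult.assoc[symmetric] ennreal_mult[symmetric])
  then have me: "measure ?L' A = measure ?L (pre A)" if "A \<in> sets borel" for A
    using that by (simp only: measure_def)
  have inj: "inj pre"
  proof (rule injI)
    fix A B assume eq: "pre A = pre B"
    have image: "(\<lambda>x. c *\<^sub>R x) ` pre A = A" for A
    proof -
      have "surj (\<lambda>x::'a. c *\<^sub>R x)"
        using c by (intro surjI[of _ "\<lambda>x. x /\<^sub>R c"]) simp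
      then show ?thesis unfolding pre_def by (rule surj_image_vimage_eq)
    qed
    have "A = (\<lambda>x. c *\<^sub>R x) ` pre A" by (rule image[symmetric])
    also have "\<dots> = (\<lambda>x. c *\<^sub>R x) ` pre B" by (simp only: eq)
    also have "\<dots> = B" by (rule image)
    finally show "A = B" .
  qed
  show ?thesis
    unfolding poisson_process_def
  proof (intro conjI allI ballI impI)
    show "(\<lambda>\<omega>. c *\<^sub>R U i \<omega>) \<in> borel_measurable M" for i
    proof -
      have "U i \<in> borel_measurable M" using U unfolding poisson_process_def by blast
      then show ?thesis by measurable
    qed
  next
    fix A :: "'a set" and n assume A: "A \<in> sets borel" "emeasure ?L' A < \<infinity>"
    then have "pre A \<in> sets borel" "emeasure ?L (pre A) < \<infinity>"
      using pre_sets em by simp_all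
    then have "measure M {\<omega> \<in> space M. point_count U (pre A) \<omega> = of_nat n} =
        measure ?L (pre A) ^ n / fact n * exp (- measure ?L (pre A))"
      using U unfolding poisson_process_def by blast
    then show "measure M {\<omega> \<in> space M. point_count (\<lambda>i \<omega>. c *\<^sub>R U i \<omega>) A \<omega> = of_nat n} =
        measure ?L' A ^ n / fact n * exp (- measure ?L' A)"
      by (simp only: count me[OF A(1)])
  next
    fix \<A> assume \<A>: "\<A> \<subseteq> {A \<in> sets borel. emeasure ?L' A < \<infinity>} \<and> disjoint \<A>"
    have "pre ` \<A> \<subseteq> {A \<in> sets borel. emeasure ?L A < \<infinity>}"
    proof
      fix B assume "B \<in> pre ` \<A>"
      then obtain A where A: "A \<in> \<A>" "B = pre A" by blast
      then have "A \<in> sets borel" "emeasure ?L' A < \<infinity>" using \<A> by blast+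
      then show "B \<in> {A \<in> sets borel. emeasure ?L A < \<infinity>}"
        unfolding A(2) using pre_sets em by simp
    qed
    moreover have "disjoint (pre ` \<A>)"
      using \<A> by (fastforce simp: disjoint_def pre_def)
    ultimately have "indep_vars (\<lambda>_. borel) (point_count U) (pre ` \<A>)"
      by (rule poisson_process_indep_counts[OF U])
    then show "indep_vars (\<lambda>_. borel) (\<lambda>A. point_count (\<lambda>i \<omega>. c *\<^sub>R U i \<omega>) A) \<A>"
      unfolding count
      by (rule indep_vars_reindex[where M' = "\<lambda>_. borel" and X = "point_count U"])
        (rule inj_on_subset[OF inj subset_UNIV])
  qed
qed

lemma displaced_poisson_scaleR:
  fixes U :: "'i::countable \<Rightarrow> 'w \<Rightarrow> 'a::euclidean_space"
  assumes "displaced_poisson M N r U \<xi> \<xi>'" and c: "0 < c"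
  shows "displaced_poisson M N (r / c ^ DIM('a)) (\<lambda>i \<omega>. c *\<^sub>R U i \<omega>) \<xi> \<xi>'"
proof -
  interpret displaced_poisson M N r U \<xi> \<xi>' by fact
  let ?B = "PiM UNIV (\<lambda>_. borel) :: ('i \<Rightarrow> 'a) measure"
  have g: "(\<lambda>v i. c *\<^sub>R v i) \<in> measurable ?B ?B"
    by (rule measurable_abs_UNIV) measurable
  have sub: "field_sigma M (\<lambda>i \<omega>. c *\<^sub>R U i \<omega>) \<subseteq> field_sigma M U"
  proof
    fix B assume "B \<in> field_sigma M (\<lambda>i \<omega>. c *\<^sub>R U i \<omega>)"
    then obtain A where "A \<in> sets ?B" "B = (\<lambda>\<omega> i. c *\<^sub>R U i \<omega>) -` A \<inter> space M"
      unfolding field_sigma_def by (subst (asm) sets_vimage_algebra2) (auto simp: space_PiM)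
    then show "B \<in> field_sigma M U"
      using vimage_in_field_sigma[OF g, of A U M] by simp
  qed
  show ?thesis
  proof unfold_locales
    show "0 \<le> r / c ^ DIM('a)" using rate_nonneg c by simp
    show "poisson_process M (scale_measure (ennreal (r / c ^ DIM('a))) lborel) (\<lambda>i \<omega>. c *\<^sub>R U i \<omega>)"
      using M.prob_space_axioms poisson rate_nonneg c by (rule poisson_process_scaleR)
    show "M.indep_set (field_sigma M (\<lambda>i \<omega>. c *\<^sub>R U i \<omega>)) (field_sigma M (\<lambda>(i, t). \<xi>' i t))"
      unfolding M.indep_set_def
      using sub by (intro M.indep_sets_mono_sets[OF indep_points[unfolded M.indep_set_def]])
        (auto split: bool.split)
  qed (fact field fields same indep_copies)+
qed

section \<open>Stationarity and min-infinite divisibility\<close>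

theorem stationary_nearest:
  fixes \<xi> :: "'t::ab_group_add \<Rightarrow> 'v \<Rightarrow> 'a::euclidean_space"
  assumes "displaced_poisson M N r U \<xi> \<xi>'" and incr: "stationary_increments N \<xi>"
  shows "stationary M (displaced_poisson.nearest U \<xi>')"
proof -
  interpret displaced_poisson M N r U \<xi> \<xi>' by fact
  have "same_fdd M (\<lambda>t. nearest (t + h)) M nearest" for h
  proof (rule same_fdd_if_upper_orthants)
    fix J :: "'t set" and a assume J: "finite J"
    have "{\<omega> \<in> space M. \<forall>t\<in>J. a t \<le> nearest (t + h) \<omega>} =
        {\<omega> \<in> space M. \<forall>s\<in>(\<lambda>t. t + h) ` J. a (s - h) \<le> nearest s \<omega>}"
      by simp
    moreover have "measure M \<dots> =
        exp (- (r * enn2real (expected_hit_volume N \<xi> ((\<lambda>t. t + h) ` J) (\<lambda>s. a (s - h)))))"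
      using J by (intro void_probability) simp
    moreover have "expected_hit_volume N \<xi> ((\<lambda>t. t + h) ` J) (\<lambda>s. a (s - h)) =
        expected_hit_volume N (\<lambda>t. \<xi> (t + h)) J a"
      by (simp add: expected_hit_volume_def)
    moreover have "\<dots> = expected_hit_volume N \<xi> J a"
      using incr J by (rule expected_hit_volume_shift)
    ultimately show "measure M {\<omega> \<in> space M. \<forall>t\<in>J. a t \<le> nearest (t + h) \<omega>} =
        measure M {\<omega> \<in> space M. \<forall>t\<in>J. a t \<le> nearest t \<omega>}"
      by (simp only: void_probability[OF J])
  qed (simp_all add: random_field_def M.prob_space_axioms)
  then show ?thesis
    by (simp add: stationary_def random_field_def)
qed

text \<open>
  Dilating the points by \<open>c\<close> with \<open>c ^ DIM('a) = n\<close> divides the rate by \<open>n\<close>. Let \<open>Q\<close> be the law on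
  path space of the negated minimum for the dilated points; the \<open>n\<close> required processes are the coordinates of
  an infinite product of copies of \<open>Q\<close>. By independence, the void probability of the minimum
  of \<open>n\<close> copies is the \<open>n\<close>-th power of \<open>exp (- (r / n) * V)\<close>, which is the void probability of the
  original process.
\<close>

theorem min_id_nearest:
  fixes U :: "'i::countable \<Rightarrow> 'w \<Rightarrow> 'a::euclidean_space" and \<xi> :: "'t \<Rightarrow> 'v \<Rightarrow> 'a"
  assumes DP: "displaced_poisson M N r U \<xi> \<xi>'"
  shows "min_id M (displaced_poisson.nearest U \<xi>')"
proof -
  interpret displaced_poisson M N r U \<xi> \<xi>' by fact
  let ?B = "PiM UNIV (\<lambda>_. borel) :: ('t \<Rightarrow> real) measure"
  have main: "\<exists>(P :: (nat \<Rightarrow> 't \<Rightarrow> real) measure) (Z :: nat \<Rightarrow> 't \<Rightarrow> (nat \<Rightarrow> 't \<Rightarrow> real) \<Rightarrow> real).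
           prob_space P \<and>
           (\<forall>j<n. random_field P (Z j)) \<and>
           prob_space.indep_vars P (\<lambda>_. ?B) (\<lambda>j \<omega> t. Z j t \<omega>) {..<n} \<and>
           (\<forall>i<n. \<forall>j<n. same_fdd P (Z i) P (Z j)) \<and>
           same_fdd M (\<lambda>t \<omega>. - nearest t \<omega>) P (\<lambda>t \<omega>. Max ((\<lambda>j. Z j t \<omega>) ` {..<n}))"
    if n: "1 \<le> n" for n :: nat
  proof -
    have n_nonempty: "{..<n} \<noteq> {}" using n by (simp add: lessThan_empty_iff)
    define c where "c = root DIM('a) (real n)"
    have c: "0 < c" "c ^ DIM('a) = real n"
      using n by (simp_all add: c_def)
    interpret D: displaced_poisson M N "r / real n" "\<lambda>i \<omega>. c *\<^sub>R U i \<omega>" \<xi> \<xi>'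
      using displaced_poisson_scaleR[OF DP c(1)] by (simp only: c(2))
    define Q where "Q = distr M ?B (\<lambda>\<omega> t. - D.nearest t \<omega>)"
    define P where "P = PiM UNIV (\<lambda>_::nat. Q)"
    have near: "(\<lambda>\<omega> t. - D.nearest t \<omega>) \<in> measurable M ?B"
      by (rule measurable_abs_UNIV) measurable
    have sets_Q [measurable_cong]: "sets Q = sets ?B" by (simp add: Q_def)
    have space_Q: "space Q = UNIV" by (simp add: Q_def space_PiM)
    have space_P: "space P = UNIV" by (simp add: P_def space_PiM space_Q)
    have prob_Q: "prob_space Q"
      unfolding Q_def by (rule M.prob_space_distr[OF near])
    interpret P: prob_space P
      unfolding P_def by (intro prob_space_PiM prob_Q)
    have path: "(\<lambda>\<omega>. \<omega> j) \<in> measurable P ?B" for j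
    proof -
      have "(\<lambda>\<omega>. \<omega> j) \<in> measurable P Q"
        unfolding P_def by (rule measurable_component_singleton) simp
      then show ?thesis by (simp only: measurable_cong_sets[OF refl sets_Q])
    qed
    have coord [measurable]: "(\<lambda>\<omega>. \<omega> j t) \<in> borel_measurable P" for j t
      by (rule measurable_compose[OF path measurable_component_singleton]) simp
    have law: "distr P ?B (\<lambda>\<omega>. \<omega> j) = Q" for j
    proof -
      have "distr P ?B (\<lambda>\<omega>. \<omega> j) = distr P Q (\<lambda>\<omega>. \<omega> j)"
        by (intro distr_cong refl) (simp add: sets_Q)
      then show ?thesis
        using distr_PiM_component[of UNIV "\<lambda>_. Q" j] prob_Q by (simp add: P_def)
    qed
    have indep: "P.indep_vars (\<lambda>_. ?B) (\<lambda>j \<omega>. \<omega> j) UNIV"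
    proof (subst P.indep_vars_iff_distr_eq_PiM')
      have "distr P (PiM UNIV (\<lambda>_. ?B)) (\<lambda>\<omega>. \<omega>) = P"
        by (intro distr_id2) (auto simp: P_def sets_Q intro!: sets_PiM_cong)
      then show "distr P (PiM UNIV (\<lambda>_. ?B)) (\<lambda>\<omega>. \<lambda>j\<in>UNIV. \<omega> j) =
          PiM UNIV (\<lambda>j. distr P ?B (\<lambda>\<omega>. \<omega> j))"
        by (simp only: law restrict_UNIV P_def[symmetric])
    qed (use path in auto)
    then have indep_n: "P.indep_vars (\<lambda>_. ?B) (\<lambda>j \<omega>. \<omega> j) {..<n}"
      by (rule P.indep_vars_subset) simp
    have same_Z: "same_fdd P (\<lambda>t \<omega>. \<omega> i t) P (\<lambda>t \<omega>. \<omega> j t)" for i j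
      unfolding same_fdd_def
    proof (intro allI impI)
      fix J :: "'t set"
      have restrict: "(\<lambda>y. \<lambda>t\<in>J. y t) \<in> measurable ?B (PiM J (\<lambda>_. borel))"
        by measurable
      have "distr P (PiM J (\<lambda>_. borel)) (\<lambda>\<omega>. \<lambda>t\<in>J. \<omega> k t) =
          distr Q (PiM J (\<lambda>_. borel)) (\<lambda>y. \<lambda>t\<in>J. y t)" for k
        unfolding law[of k, symmetric] by (subst distr_distr[OF restrict path]) (simp add: comp_def)
      then show "distr P (PiM J (\<lambda>_. borel)) (\<lambda>\<omega>. \<lambda>t\<in>J. \<omega> i t) =
          distr P (PiM J (\<lambda>_. borel)) (\<lambda>\<omega>. \<lambda>t\<in>J. \<omega> j t)" by simp
    qed
    have Max_meas [measurable]: "(\<lambda>\<omega>. Max ((\<lambda>j. \<omega> j t) ` {..<n})) \<in> borel_measurable P" for t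
      by measurable
    have "same_fdd M nearest P (\<lambda>t \<omega>. - Max ((\<lambda>j. \<omega> j t) ` {..<n}))"
    proof (rule same_fdd_if_upper_orthants)
      fix J :: "'t set" and a assume J: "finite J"
      let ?V = "enn2real (expected_hit_volume N \<xi> J a)"
      define E where "E = {y \<in> space ?B. \<forall>t\<in>J. a t \<le> - y t}"
      have E: "E \<in> sets ?B"
        unfolding E_def using J by measurable
      have prob_E: "P.prob ((\<lambda>\<omega>. \<omega> j) -` E \<inter> space P) = exp (- (r / real n * ?V))" for j
      proof -
        have "P.prob ((\<lambda>\<omega>. \<omega> j) -` E \<inter> space P) = measure Q E"
          unfolding law[of j, symmetric] by (rule measure_distr[OF path E, symmetric])
        also have "\<dots> = measure M ((\<lambda>\<omega> t. - D.nearest t \<omega>) -` E \<inter> space M)"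
          unfolding Q_def by (rule measure_distr[OF near E])
        also have "(\<lambda>\<omega> t. - D.nearest t \<omega>) -` E \<inter> space M =
            {\<omega> \<in> space M. \<forall>t\<in>J. a t \<le> D.nearest t \<omega>}"
          by (auto simp: E_def space_PiM)
        finally show ?thesis by (simp only: D.void_probability[OF J])
      qed
      have "{\<omega> \<in> space P. \<forall>t\<in>J. a t \<le> - Max ((\<lambda>j. \<omega> j t) ` {..<n})} =
          (\<Inter>j\<in>{..<n}. (\<lambda>\<omega>. \<omega> j) -` E \<inter> space P)"
      proof -
        have "a t \<le> - Max ((\<lambda>j. \<omega> j t) ` {..<n}) \<longleftrightarrow> (\<forall>j<n. a t \<le> - \<omega> j t)" for t \<omega>
        proof -
          have "Max ((\<lambda>j. \<omega> j t) ` {..<n}) \<le> - a t \<longleftrightarrow> (\<forall>j<n. \<omega> j t \<le> - a t)"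
            using n_nonempty by (subst Max_le_iff) auto
          then show ?thesis by (simp add: le_minus_iff minus_le_iff)
        qed
        then show ?thesis using n_nonempty by (auto simp: E_def space_P space_PiM)
      qed
      then have "P.prob {\<omega> \<in> space P. \<forall>t\<in>J. a t \<le> - Max ((\<lambda>j. \<omega> j t) ` {..<n})} =
          (\<Prod>j\<in>{..<n}. P.prob ((\<lambda>\<omega>. \<omega> j) -` E \<inter> space P))"
        using P.indep_varsD_finite[OF indep_n n_nonempty finite_lessThan E] by (simp only:)
      also have "\<dots> = exp (- (r * ?V))"
        using n by (simp add: prob_E exp_of_nat_mult[symmetric])
      finally show "measure M {\<omega> \<in> space M. \<forall>t\<in>J. a t \<le> nearest t \<omega>} =
          P.prob {\<omega> \<in> space P. \<forall>t\<in>J. a t \<le> - Max ((\<lambda>j. \<omega> j t) ` {..<n})}"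
        by (simp only: void_probability[OF J])
    qed (simp_all add: random_field_def M.prob_space_axioms P.prob_space_axioms)
    from same_fdd_compose[OF _ _ this, of uminus]
    have "same_fdd M (\<lambda>t \<omega>. - nearest t \<omega>) P (\<lambda>t \<omega>. Max ((\<lambda>j. \<omega> j t) ` {..<n}))"
      by (simp add: random_field_def)
    then show ?thesis
      using P.prob_space_axioms indep_n same_Z
      by (intro exI[of _ P] exI[of _ "\<lambda>j t \<omega>. \<omega> j t"]) (simp add: random_field_def)
  qed
  then show ?thesis
    unfolding min_id_def max_id_def by (simp add: random_field_def)
qed

theorem proposition4p7:
  fixes M :: "'w measure" and N :: "'v measure"
    and rate :: real
    and U :: "int \<Rightarrow> 'w \<Rightarrow> real ^ 'k::finite"
    and \<xi> :: "real ^ 'd::finite \<Rightarrow> 'v \<Rightarrow> real ^ 'k"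
    and \<xi>' :: "int \<Rightarrow> real ^ 'd \<Rightarrow> 'w \<Rightarrow> real ^ 'k"
    and X :: "real ^ 'd \<Rightarrow> 'w \<Rightarrow> real"
  assumes "prob_space M" and "prob_space N"
    and "rate > 0"
    and "poisson_process M (scale_measure (ennreal rate) lborel) U"
    and "stationary_increments N \<xi>"
    and "\<And>i. random_field M (\<xi>' i)"
    and "\<And>i. same_fdd M (\<xi>' i) N \<xi>"
    and "prob_space.indep_vars M (\<lambda>_. PiM UNIV (\<lambda>_. borel)) (\<lambda>i \<omega> t. \<xi>' i t \<omega>) UNIV"
    and "prob_space.indep_set M (field_sigma M U) (field_sigma M (\<lambda>(i, t). \<xi>' i t))"
    and "\<And>t \<omega>. X t \<omega> = (INF i. norm (U i \<omega> + \<xi>' i t \<omega>))"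
  shows "(\<forall>t. AE \<omega> in M. \<exists>i. X t \<omega> = norm (U i \<omega> + \<xi>' i t \<omega>)) \<and>
         stationary M X \<and> min_id M X"
proof -
  interpret displaced_poisson M N rate U \<xi> \<xi>'
    using assms by (intro displaced_poisson.intro displaced_poisson_axioms.intro)
      (simp_all add: stationary_increments_def)
  have X: "X = nearest"
    using assms(10) by (simp add: fun_eq_iff nearest_def)
  show ?thesis
    unfolding X
    using nearest_attained stationary_nearest[OF displaced_poisson_axioms assms(5)]
      min_id_nearest[OF displaced_poisson_axioms] by blast
qed

end
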